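(* Let $R$ be a commutative ring of characteristic zero (i.e. $R\to R\otimes\mathbb{Q}$ is injective) and let $V(x)\in R[x_1^{\pm1},\dots,x_m^{\pm1}]$ be a Laurent polynomial whose Newton polytope $\Delta(V)\subset\mathbb{R}^m$ contains a unique internal integral point $w$, i.e. $\{w\}=\Delta(V)^{\circ}\cap\mathbb{Z}^m$. For $n\ge0$ let $b_n\in R$ be the coefficient of $x^{nw}$ in $V(x)^n$. Put $f(x)=\sum_{n=1}^\infty\frac{b_{n-1}}{n}x^n$ (a power series in one variable $x$ over $R\otimes\mathbb{Q}$) and $$F_V(x,y)=f^{-1}(f(x)+f(y)),$$ where $f^{-1}$ is the compositional inverse. Let $p$ be a prime such that $R$ can be equipped with a $p$th power Frobenius endomorphism, i.e. a ring endomorphism $\sigma:R\to R$ with $\sigma(r)\equiv r^p\bmod pR$ for all $r\in R$. Then the formal group law $F_V(x,y)$ has coefficients in $R\otimes\mathbb{Z}_{(p)}$.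
   Context: The Newton polytope $\Delta(V)$ is the convex hull in $\mathbb{R}^m$ of the exponent vectors of the monomials occurring in $V$ with nonzero coefficient. $\Delta(V)^\circ$ denotes its (relative) interior. For $u\in\mathbb{Z}^m$, $x^u=x_1^{u_1}\cdots x_m^{u_m}$. *)

theory Defs
  imports "HOL-Analysis.Analysis" "HOL-Library.Poly_Mapping"
begin

section \<open>The ring \<open>R \<otimes> \<rat>\<close>\<close>

text \<open>
  \<open>R \<otimes> \<rat>\<close> is realised as the localisation of \<open>R\<close> at the positive integers. Since \<open>R\<close> may have
  torsion at this point, fractions are identified only up to multiplication by a positive integer.
  The lemma \<open>tensor_universal\<close> below shows that this is the tensor product over the integers.
\<close>

definition ratrel :: "'a::comm_ring_1 \<times> nat \<Rightarrow> 'a \<times> nat \<Rightarrow> bool" where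
  "ratrel x y \<longleftrightarrow> snd x > 0 \<and> snd y > 0 \<and>
     (\<exists>k>0. of_nat k * (of_nat (snd y) * fst x) = of_nat k * (of_nat (snd x) * fst y))"

lemma ratrelI:
  "n > 0 \<Longrightarrow> m > 0 \<Longrightarrow> k > 0 \<Longrightarrow> of_nat k * (of_nat m * r) = of_nat k * (of_nat n * s)
    \<Longrightarrow> ratrel (r, n) (s, m)"
  by (auto simp: ratrel_def)

lemma part_equivp_ratrel: "part_equivp ratrel"
proof (rule part_equivpI)
  show "\<exists>x::'a \<times> nat. ratrel x x"
    by (rule exI[of _ "(0, 1)"]) (auto simp: ratrel_def)
  show "symp ratrel"
    by (rule sympI) (metis ratrel_def)
  show "transp (ratrel :: 'a \<times> nat \<Rightarrow> _)"
  proof (rule transpI, unfold split_paired_all)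
    fix a b c :: 'a and n m l :: nat
    assume "ratrel (a, n) (b, m)" and "ratrel (b, m) (c, l)"
    then obtain k k' where k: "k > 0" "k' > 0" "n > 0" "m > 0" "l > 0"
      and e: "of_nat k * (of_nat m * a) = of_nat k * (of_nat n * b)"
      and e': "of_nat k' * (of_nat l * b) = of_nat k' * (of_nat m * c)"
      by (auto simp: ratrel_def)
    have "of_nat (k * k' * m) * (of_nat l * a) = of_nat (k' * l) * (of_nat k * (of_nat m * a))"
      by (simp add: ac_simps)
    also have "\<dots> = of_nat (k * n) * (of_nat k' * (of_nat l * b))"
      unfolding e by (simp add: ac_simps)
    also have "\<dots> = of_nat (k * k' * m) * (of_nat n * c)"
      unfolding e' by (simp add: ac_simps)
    finally show "ratrel (a, n) (c, l)"
      using k by (intro ratrelI[of _ _ "k * k' * m"]) auto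
  qed
qed

quotient_type (overloaded) 'a tensor_rat = "'a::comm_ring_1 \<times> nat" / partial: ratrel
  by (rule part_equivp_ratrel)

lift_definition tfrac :: "'a::comm_ring_1 \<Rightarrow> nat \<Rightarrow> 'a tensor_rat"
  is "\<lambda>r n. if n = 0 then (0, 1) else (r, n)"
  by (auto simp: ratrel_def intro: exI[of _ 1])

lemma tfrac_cases:
  obtains r n where "x = tfrac r n" "n > 0"
  by transfer (auto simp: ratrel_def)

lemma tfrac_eq_iff:
  "n > 0 \<Longrightarrow> m > 0 \<Longrightarrow> tfrac r n = tfrac s m \<longleftrightarrow>
    (\<exists>k>0. of_nat k * (of_nat m * r) = of_nat k * (of_nat n * s))"
  by transfer (auto simp: ratrel_def)

lemma tfrac_eqI:
  "n > 0 \<Longrightarrow> m > 0 \<Longrightarrow> of_nat m * r = of_nat n * s \<Longrightarrow> tfrac r n = tfrac s m"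
  by (subst tfrac_eq_iff) (auto intro: exI[of _ 1])

instantiation tensor_rat :: (comm_ring_1) "{comm_ring, comm_monoid_mult}"
begin

lift_definition zero_tensor_rat :: "'a tensor_rat" is "(0, 1)"
  by (auto simp: ratrel_def)

lift_definition one_tensor_rat :: "'a tensor_rat" is "(1, 1)"
  by (auto simp: ratrel_def intro: exI[of _ 1])

lift_definition plus_tensor_rat :: "'a tensor_rat \<Rightarrow> 'a tensor_rat \<Rightarrow> 'a tensor_rat"
  is "\<lambda>x y. (of_nat (snd y) * fst x + of_nat (snd x) * fst y, snd x * snd y)"
proof (unfold split_paired_all)
  fix a b c d :: 'a and n m l j :: nat
  assume "ratrel (a, n) (b, m)" and "ratrel (c, l) (d, j)"
  then obtain k k' where k: "k > 0" "k' > 0" "n > 0" "m > 0" "l > 0" "j > 0"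
    and e: "of_nat k * (of_nat m * a) = of_nat k * (of_nat n * b)"
    and e': "of_nat k' * (of_nat j * c) = of_nat k' * (of_nat l * d)"
    by (auto simp: ratrel_def)
  have "of_nat (k * k') * (of_nat (m * j) * (of_nat l * a + of_nat n * c))
      = of_nat (k' * j * l) * (of_nat k * (of_nat m * a)) + of_nat (k * m * n) * (of_nat k' * (of_nat j * c))"
    by (simp add: algebra_simps)
  also have "\<dots> = of_nat (k * k') * (of_nat (n * l) * (of_nat j * b + of_nat m * d))"
    unfolding e e' by (simp add: algebra_simps)
  finally show "ratrel (of_nat (snd (c, l)) * fst (a, n) + of_nat (snd (a, n)) * fst (c, l), snd (a, n) * snd (c, l))
       (of_nat (snd (d, j)) * fst (b, m) + of_nat (snd (b, m)) * fst (d, j), snd (b, m) * snd (d, j))"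
    using k by (auto intro!: ratrelI[of _ _ "k * k'"])
qed

lift_definition uminus_tensor_rat :: "'a tensor_rat \<Rightarrow> 'a tensor_rat"
  is "\<lambda>x. (- fst x, snd x)"
  by (auto simp: ratrel_def)

definition minus_tensor_rat :: "'a tensor_rat \<Rightarrow> 'a tensor_rat \<Rightarrow> 'a tensor_rat"
  where "minus_tensor_rat x y = x + - y"

lift_definition times_tensor_rat :: "'a tensor_rat \<Rightarrow> 'a tensor_rat \<Rightarrow> 'a tensor_rat"
  is "\<lambda>x y. (fst x * fst y, snd x * snd y)"
proof (unfold split_paired_all)
  fix a b c d :: 'a and n m l j :: nat
  assume "ratrel (a, n) (b, m)" and "ratrel (c, l) (d, j)"
  then obtain k k' where k: "k > 0" "k' > 0" "n > 0" "m > 0" "l > 0" "j > 0"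
    and e: "of_nat k * (of_nat m * a) = of_nat k * (of_nat n * b)"
    and e': "of_nat k' * (of_nat j * c) = of_nat k' * (of_nat l * d)"
    by (auto simp: ratrel_def)
  have "of_nat (k * k') * (of_nat (m * j) * (a * c))
      = (of_nat k * (of_nat m * a)) * (of_nat k' * (of_nat j * c))"
    by (simp add: algebra_simps)
  also have "\<dots> = of_nat (k * k') * (of_nat (n * l) * (b * d))"
    unfolding e e' by (simp add: algebra_simps)
  finally show "ratrel (fst (a, n) * fst (c, l), snd (a, n) * snd (c, l))
       (fst (b, m) * fst (d, j), snd (b, m) * snd (d, j))"
    using k by (auto intro!: ratrelI[of _ _ "k * k'"])
qed

lemma zero_tensor_rat_tfrac: "0 = tfrac 0 1"
  by transfer (auto simp: ratrel_def)

lemma one_tensor_rat_tfrac: "1 = tfrac 1 1"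
  by transfer (auto simp: ratrel_def intro: exI[of _ 1])

lemma add_tfrac:
  "n > 0 \<Longrightarrow> m > 0 \<Longrightarrow> tfrac r n + tfrac s m = tfrac (of_nat m * r + of_nat n * s) (n * m)"
  by transfer (auto simp: ratrel_def intro: exI[of _ 1])

lemma uminus_tfrac: "n > 0 \<Longrightarrow> - tfrac r n = tfrac (- r) n"
  by transfer (auto simp: ratrel_def intro: exI[of _ 1])

lemma mult_tfrac: "n > 0 \<Longrightarrow> m > 0 \<Longrightarrow> tfrac r n * tfrac s m = tfrac (r * s) (n * m)"
  by transfer (auto simp: ratrel_def intro: exI[of _ 1])

instance
proof
  fix x y z :: "'a tensor_rat"
  obtain a n where x: "x = tfrac a n" "n > 0" by (rule tfrac_cases)
  obtain b m where y: "y = tfrac b m" "m > 0" by (rule tfrac_cases)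
  obtain c l where z: "z = tfrac c l" "l > 0" by (rule tfrac_cases)
  note s = x y z add_tfrac mult_tfrac uminus_tfrac zero_tensor_rat_tfrac one_tensor_rat_tfrac
  show "x + y + z = x + (y + z)" by (simp add: s algebra_simps)
  show "x + y = y + x" by (simp add: s algebra_simps)
  show "0 + x = x" by (simp add: s)
  show "- x + x = 0" by (simp add: s tfrac_eqI)
  show "x - y = x + - y" by (simp add: minus_tensor_rat_def)
  show "x * y * z = x * (y * z)" by (simp add: s algebra_simps)
  show "x * y = y * x" by (simp add: s algebra_simps)
  show "1 * x = x" by (simp add: s)
  show "(x + y) * z = x * z + y * z" by (simp add: s tfrac_eqI algebra_simps)
qed

end

text \<open>
  If \<open>1\<close> is torsion in \<open>R\<close>, then \<open>R \<otimes> \<rat> = 0\<close>; hence the additional sort constraint for \<open>1 \<noteq> 0\<close>.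
  By \<open>inj_of_base_imp_char_0\<close> below it is no restriction when \<open>R \<rightarrow> R \<otimes> \<rat>\<close> is injective.
\<close>

instance tensor_rat :: ("{comm_ring_1, ring_char_0}") comm_ring_1
proof
  show "(0 :: 'a tensor_rat) \<noteq> 1"
    by (simp add: zero_tensor_rat_tfrac one_tensor_rat_tfrac tfrac_eq_iff)
qed

text \<open>The pure tensor \<open>r \<otimes> q\<close>.\<close>

definition tensor :: "'a::comm_ring_1 \<Rightarrow> rat \<Rightarrow> 'a tensor_rat" where
  "tensor r q = (case quotient_of q of (a, d) \<Rightarrow> tfrac (of_int a * r) (nat d))"

definition of_base :: "'a::comm_ring_1 \<Rightarrow> 'a tensor_rat" where
  "of_base r = tensor r 1"

lemma tensor_tfrac:
  fixes r :: "'a::comm_ring_1"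
  assumes "n > 0"
  shows "tensor r (of_int a / of_nat n) = tfrac (of_int a * r) n"
proof -
  obtain b d where q: "quotient_of (of_int a / of_nat n) = (b, d)"
    by (cases "quotient_of (of_int a / of_nat n)")
  have d: "d > 0" using quotient_of_denom_pos[OF q] .
  have "(of_int a :: rat) / of_nat n = of_int b / of_int d"
    using quotient_of_div[OF q] .
  hence "(of_int (a * d) :: rat) = of_int (b * int n)"
    using assms d by (simp add: field_simps)
  hence eq: "a * d = b * int n" by (simp only: of_int_eq_iff)
  have "of_nat n * (of_int b * r) = of_int (b * int n) * r"
    by (simp add: mult_ac)
  also have "\<dots> = of_int d * (of_int a * r)"
    unfolding eq[symmetric] by (simp add: mult_ac)
  also have "of_int d = (of_nat (nat d) :: 'a)"
    using d by simp
  finally have "tfrac (of_int b * r) (nat d) = tfrac (of_int a * r) n"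
    using assms d by (intro tfrac_eqI) simp_all
  thus ?thesis by (simp add: tensor_def q)
qed

lemma tfrac_conv_tensor: "n > 0 \<Longrightarrow> tfrac r n = tensor r (1 / of_nat n)"
  by (metis tensor_tfrac of_int_1 mult_1)

lemma of_base_tfrac: "of_base r = tfrac r 1"
  by (metis tfrac_conv_tensor of_base_def zero_less_one of_nat_1 div_by_1)

lemma rat_as_fraction:
  fixes q :: rat
  obtains a :: int and n :: nat where "q = of_int a / of_nat n" "n > 0"
proof -
  obtain a d where "quotient_of q = (a, d)" by (cases "quotient_of q")
  thus thesis using that[of a "nat d"] quotient_of_div[of q a d] quotient_of_denom_pos[of q a d] by simp
qed

lemma tensor_add_left: "tensor (r + s) q = tensor r q + tensor s q"
proof -
  obtain a n where q: "q = of_int a / of_nat n" "n > 0" by (rule rat_as_fraction)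
  have "tensor (r + s) q = tfrac (of_int a * (r + s)) n"
    unfolding q(1) using q(2) by (rule tensor_tfrac)
  also have "\<dots> = tfrac (of_nat n * (of_int a * r) + of_nat n * (of_int a * s)) (n * n)"
    using q(2) by (intro tfrac_eqI) (simp_all add: algebra_simps)
  also have "\<dots> = tensor r q + tensor s q"
    unfolding q(1) using q(2) by (simp only: tensor_tfrac add_tfrac)
  finally show ?thesis .
qed

lemma tensor_add_right: "tensor r (q + q') = tensor r q + tensor r q'"
proof -
  obtain a n where q: "q = of_int a / of_nat n" "n > 0" by (rule rat_as_fraction)
  obtain b m where q': "q' = of_int b / of_nat m" "m > 0" by (rule rat_as_fraction)
  have "q + q' = of_int (a * int m + b * int n) / of_nat (n * m)"
    using q q' by (simp add: add_frac_eq)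
  hence "tensor r (q + q') = tfrac (of_int (a * int m + b * int n) * r) (n * m)"
    using q(2) q'(2) by (simp only:) (intro tensor_tfrac, simp)
  also have "of_int (a * int m + b * int n) * r = of_nat m * (of_int a * r) + of_nat n * (of_int b * r)"
    by (simp add: algebra_simps)
  also have "tfrac \<dots> (n * m) = tfrac (of_int a * r) n + tfrac (of_int b * r) m"
    using q(2) q'(2) by (simp only: add_tfrac)
  also have "\<dots> = tensor r q + tensor r q'"
    unfolding q(1) q'(1) using q(2) q'(2) by (simp only: tensor_tfrac)
  finally show ?thesis .
qed

lemma tensor_mult: "tensor r q * tensor s q' = tensor (r * s) (q * q')"
proof -
  obtain a n where q: "q = of_int a / of_nat n" "n > 0" by (rule rat_as_fraction)
  obtain b m where q': "q' = of_int b / of_nat m" "m > 0" by (rule rat_as_fraction)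
  have "q * q' = of_int (a * b) / of_nat (n * m)"
    using q q' by simp
  hence "tensor (r * s) (q * q') = tfrac (of_int (a * b) * (r * s)) (n * m)"
    using q(2) q'(2) by (simp only:) (intro tensor_tfrac, simp)
  also have "of_int (a * b) * (r * s) = (of_int a * r) * (of_int b * s)"
    by (simp add: algebra_simps)
  also have "tfrac \<dots> (n * m) = tfrac (of_int a * r) n * tfrac (of_int b * s) m"
    using q(2) q'(2) by (simp only: mult_tfrac)
  also have "\<dots> = tensor r q * tensor s q'"
    unfolding q(1) q'(1) using q(2) q'(2) by (simp only: tensor_tfrac)
  finally show ?thesis ..
qed

lemma tensor_universal:
  fixes \<beta> :: "'a::comm_ring_1 \<Rightarrow> rat \<Rightarrow> 'b::ab_group_add"
  assumes l: "\<And>r s q. \<beta> (r + s) q = \<beta> r q + \<beta> s q"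
    and r: "\<And>r q q'. \<beta> r (q + q') = \<beta> r q + \<beta> r q'"
  shows "\<exists>!h :: 'a tensor_rat \<Rightarrow> 'b. (\<forall>x y. h (x + y) = h x + h y) \<and> (\<forall>r q. h (tensor r q) = \<beta> r q)"
proof -
  have z: "\<beta> r 0 = 0" "\<beta> 0 q = 0" for r q
    using r[of r 0 0] l[of 0 0 q] by simp_all
  have bal: "\<beta> (of_nat k * r) q = \<beta> r (of_nat k * q)" for k r q
    by (induction k) (simp_all add: z l r algebra_simps)
  have m: "\<beta> (- r) q = \<beta> r (- q)" for r q
    using l[of r "- r" q] r[of r q "- q"] by (simp add: z) (metis add_left_imp_eq)
  have bali: "\<beta> (of_int a * r) q = \<beta> r (of_int a * q)" for a r q
    by (cases a rule: int_cases2) (simp_all add: bal m)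
  have wd: "\<beta> r (1 / of_nat n) = \<beta> s (1 / of_nat m)"
    if fr: "tfrac r n = tfrac s m" and n: "n > 0" and m: "m > 0" for r s n m
  proof -
    obtain k where k: "k > 0" "of_nat k * (of_nat m * r) = of_nat k * (of_nat n * s)"
      using fr n m by (auto simp: tfrac_eq_iff)
    let ?u = "1 / of_nat (k * m * n) :: rat"
    have "\<beta> r (1 / of_nat n) = \<beta> (of_nat (k * m) * r) ?u"
      unfolding bal using k n m by (simp add: field_simps)
    also have "of_nat (k * m) * r = of_nat (k * n) * s"
      using k by (simp add: mult.assoc)
    also have "\<beta> (of_nat (k * n) * s) ?u = \<beta> s (1 / of_nat m)"
      unfolding bal using k n m by (simp add: field_simps)
    finally show ?thesis .
  qed
  define P where "P x v \<longleftrightarrow> (\<exists>r n. n > 0 \<and> x = tfrac r n \<and> v = \<beta> r (1 / of_nat n))"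
    for x :: "'a tensor_rat" and v
  define h where "h x = (THE v. P x v)" for x
  have h: "h (tfrac r n) = \<beta> r (1 / of_nat n)" if "n > 0" for r n
    unfolding h_def
  proof (rule the_equality)
    show "P (tfrac r n) (\<beta> r (1 / of_nat n))"
      unfolding P_def using that by blast
    fix v assume "P (tfrac r n) v"
    then obtain s m where "m > 0" "tfrac r n = tfrac s m" "v = \<beta> s (1 / of_nat m)"
      unfolding P_def by blast
    thus "v = \<beta> r (1 / of_nat n)" using wd[of r n s m] that by simp
  qed
  have hadd: "h (x + y) = h x + h y" for x y
  proof -
    obtain a n where x: "x = tfrac a n" "n > 0" by (rule tfrac_cases)
    obtain b m where y: "y = tfrac b m" "m > 0" by (rule tfrac_cases)
    have "h (x + y) = \<beta> (of_nat m * a + of_nat n * b) (1 / of_nat (n * m))"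
      using x y h[of "n * m"] by (simp add: add_tfrac del: of_nat_mult)
    also have "\<dots> = \<beta> a (of_nat m * (1 / of_nat (n * m))) + \<beta> b (of_nat n * (1 / of_nat (n * m)))"
      by (simp only: l bal)
    also have "\<dots> = h x + h y"
      using x y by (simp add: h)
    finally show ?thesis .
  qed
  have htens: "h (tensor r q) = \<beta> r q" for r q
    by (rule rat_as_fraction[of q]) (auto simp: tensor_tfrac h bali)
  show ?thesis
  proof (rule ex1I[of _ h])
    show "(\<forall>x y. h (x + y) = h x + h y) \<and> (\<forall>r q. h (tensor r q) = \<beta> r q)"
      using hadd htens by blast
    fix g assume g: "(\<forall>x y. g (x + y) = g x + g y) \<and> (\<forall>r q. g (tensor r q) = \<beta> r q)"
    show "g = h"
    proof
      fix x :: "'a tensor_rat"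
      obtain a n where x: "x = tfrac a n" "n > 0" by (rule tfrac_cases)
      thus "g x = h x" using g htens by (simp add: tfrac_conv_tensor)
    qed
  qed
qed

lemma inj_of_base_imp_char_0:
  assumes "inj (of_base :: 'a::comm_ring_1 \<Rightarrow> 'a tensor_rat)"
  shows "inj (of_nat :: nat \<Rightarrow> 'a)"
proof -
  have aux: False if "of_nat n = (of_nat (n + Suc k) :: 'a)" for n k
  proof -
    have "of_nat (Suc k) = (0 :: 'a)" using that by simp
    hence "of_base (1 :: 'a) = of_base 0"
      by (auto simp: of_base_tfrac tfrac_eq_iff simp del: of_nat_Suc intro!: exI[of _ "Suc k"])
    thus False using assms by (simp add: inj_eq)
  qed
  show ?thesis
  proof (rule injI)
    fix n m :: nat assume "of_nat n = (of_nat m :: 'a)"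
    thus "n = m"
      using aux[of n "m - Suc n"] aux[of m "n - Suc m"] by (cases n m rule: linorder_cases) auto
  qed
qed

text \<open>\<open>\<int>\<^sub>(\<^sub>p\<^sub>)\<close>; for \<open>d = 0\<close> the condition fails.\<close>

definition Z_loc :: "nat \<Rightarrow> rat set" where
  "Z_loc p = {of_int a / of_nat d | a d. \<not> p dvd d}"

text \<open>
  The image of \<open>R \<otimes> \<int>\<^sub>(\<^sub>p\<^sub>)\<close> in \<open>R \<otimes> \<rat>\<close>. If \<open>R\<close> is torsion-free, it is flat over the integers, so
  \<open>R \<otimes> \<int>\<^sub>(\<^sub>p\<^sub>) \<rightarrow> R \<otimes> \<rat>\<close> is injective.
\<close>

definition tensor_Z_loc :: "nat \<Rightarrow> 'a::comm_ring_1 tensor_rat set" where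
  "tensor_Z_loc p = {(\<Sum>i<k. tensor (r i) (q i)) | (k::nat) r q. \<forall>i<k. q i \<in> Z_loc p}"


section \<open>Frobenius lifts\<close>

definition ring_endomorphism :: "('a::comm_ring_1 \<Rightarrow> 'a) \<Rightarrow> bool" where
  "ring_endomorphism \<sigma> \<longleftrightarrow>
     \<sigma> 1 = 1 \<and> (\<forall>r s. \<sigma> (r + s) = \<sigma> r + \<sigma> s) \<and> (\<forall>r s. \<sigma> (r * s) = \<sigma> r * \<sigma> s)"

definition frobenius_lift :: "nat \<Rightarrow> ('a::comm_ring_1 \<Rightarrow> 'a) \<Rightarrow> bool" where
  "frobenius_lift p \<sigma> \<longleftrightarrow> ring_endomorphism \<sigma> \<and> (\<forall>r. of_nat p dvd \<sigma> r - r ^ p)"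


section \<open>Laurent polynomials and Newton polytopes\<close>

text \<open>A Laurent polynomial is the finitely supported map from exponent vectors to coefficients.\<close>

type_synonym ('a, 'm) laurent_poly = "(int ^ 'm) \<Rightarrow>\<^sub>0 'a"

definition real_vec :: "int ^ 'm \<Rightarrow> real ^ 'm" where
  "real_vec u = (\<chi> i. real_of_int (vec_nth u i))"

definition newton_polytope :: "('a::zero, 'm::finite) laurent_poly \<Rightarrow> (real ^ 'm) set" where
  "newton_polytope V = convex hull (real_vec ` Poly_Mapping.keys V)"

definition central_coeff ::
    "('a::comm_ring_1, 'm::finite) laurent_poly \<Rightarrow> int ^ 'm \<Rightarrow> nat \<Rightarrow> 'a" where
  "central_coeff V w n = Poly_Mapping.lookup (V ^ n) (int n *s w)"


section \<open>Power series in one and two variables\<close>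

text \<open>
  The library's \<open>fps_inv\<close> requires coefficients in a field. The description below determines a
  unique series whenever the linear coefficient is \<open>1\<close>, see \<open>comp_inverse_exists_unique\<close>.
\<close>

definition comp_inverse :: "'a::comm_ring_1 fps \<Rightarrow> 'a fps" where
  "comp_inverse f = (THE g. fps_nth g 0 = 0 \<and> f oo g = fps_X \<and> g oo f = fps_X)"

lemma fps_compose_nth_upto:
  fixes a c :: "'a::comm_ring_1 fps"
  assumes "fps_nth c 0 = 0" and "n \<le> N"
  shows "fps_nth (a oo c) n = (\<Sum>i\<le>N. fps_nth a i * fps_nth (c ^ i) n)"
  unfolding fps_compose_nth atLeast0AtMost
  using assms startsby_zero_power_prefix[of c] by (intro sum.mono_neutral_left) auto

lemma fps_compose_mult_comm_ring:
  fixes a b c :: "'a::comm_ring_1 fps"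
  assumes c: "fps_nth c 0 = 0"
  shows "(a * b) oo c = (a oo c) * (b oo c)"
proof (rule fps_ext)
  fix n
  have zero: "fps_nth (c ^ (i + j)) n = 0" if "\<not> j \<le> n - i" "i \<le> n" for i j
    using startsby_zero_power_prefix[OF c, of "i + j"] that by auto
  have "fps_nth ((a oo c) * (b oo c)) n =
      (\<Sum>k\<le>n. (\<Sum>i\<le>n. fps_nth a i * fps_nth (c ^ i) k) * (\<Sum>j\<le>n. fps_nth b j * fps_nth (c ^ j) (n - k)))"
    by (simp add: fps_mult_nth atLeast0AtMost fps_compose_nth_upto[OF c, of _ n])
  also have "\<dots> = (\<Sum>k\<le>n. \<Sum>i\<le>n. \<Sum>j\<le>n.
      fps_nth a i * fps_nth b j * (fps_nth (c ^ i) k * fps_nth (c ^ j) (n - k)))"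
    by (simp add: sum_product ac_simps)
  also have "\<dots> = (\<Sum>i\<le>n. \<Sum>k\<le>n. \<Sum>j\<le>n.
      fps_nth a i * fps_nth b j * (fps_nth (c ^ i) k * fps_nth (c ^ j) (n - k)))"
    by (rule sum.swap)
  also have "\<dots> = (\<Sum>i\<le>n. \<Sum>j\<le>n. \<Sum>k\<le>n.
      fps_nth a i * fps_nth b j * (fps_nth (c ^ i) k * fps_nth (c ^ j) (n - k)))"
    by (intro sum.cong refl sum.swap)
  also have "\<dots> = (\<Sum>i\<le>n. \<Sum>j\<le>n. fps_nth a i * fps_nth b j * fps_nth (c ^ (i + j)) n)"
    by (simp add: power_add fps_mult_nth atLeast0AtMost sum_distrib_left)
  also have "\<dots> = (\<Sum>i\<le>n. \<Sum>j\<le>n - i. fps_nth a i * fps_nth b j * fps_nth (c ^ (i + j)) n)"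
    by (rule sum.cong[OF refl], rule sum.mono_neutral_right)
      (auto simp: zero)
  also have "\<dots> = (\<Sum>(i, j)\<in>(SIGMA i:{..n}. {..n - i}). fps_nth a i * fps_nth b j * fps_nth (c ^ (i + j)) n)"
    by (simp add: sum.Sigma)
  also have "\<dots> = (\<Sum>(s, i)\<in>(SIGMA s:{..n}. {..s}). fps_nth a i * fps_nth b (s - i) * fps_nth (c ^ s) n)"
    by (rule sum.reindex_bij_witness[of _ "\<lambda>(s, i). (i, s - i)" "\<lambda>(i, j). (i + j, i)"]) auto
  also have "\<dots> = (\<Sum>s\<le>n. \<Sum>i\<le>s. fps_nth a i * fps_nth b (s - i) * fps_nth (c ^ s) n)"
    by (simp add: sum.Sigma)
  also have "\<dots> = fps_nth ((a * b) oo c) n"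
    by (simp add: fps_compose_nth fps_mult_nth atLeast0AtMost sum_distrib_right)
  finally show "fps_nth ((a * b) oo c) n = fps_nth ((a oo c) * (b oo c)) n" ..
qed

lemma fps_compose_assoc_comm_ring:
  fixes a b c :: "'a::comm_ring_1 fps"
  assumes b: "fps_nth b 0 = 0" and c: "fps_nth c 0 = 0"
  shows "a oo (b oo c) = (a oo b) oo c"
proof (rule fps_ext)
  fix n
  have pow: "(b oo c) ^ i = b ^ i oo c" for i
    by (induction i) (simp_all add: fps_compose_mult_comm_ring[OF c])
  have "fps_nth (a oo (b oo c)) n =
      (\<Sum>i\<le>n. \<Sum>j\<le>n. fps_nth a i * fps_nth (b ^ i) j * fps_nth (c ^ j) n)"
    by (simp add: fps_compose_nth[of a] pow atLeast0AtMost fps_compose_nth_upto[OF c, of n n]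
        sum_distrib_left mult.assoc)
  also have "\<dots> = (\<Sum>j\<le>n. \<Sum>i\<le>n. fps_nth a i * fps_nth (b ^ i) j * fps_nth (c ^ j) n)"
    by (rule sum.swap)
  also have "\<dots> = fps_nth ((a oo b) oo c) n"
    by (simp add: fps_compose_nth[of "a oo b"] atLeast0AtMost fps_compose_nth_upto[OF b, of _ n]
        sum_distrib_right)
  finally show "fps_nth (a oo (b oo c)) n = fps_nth ((a oo b) oo c) n" .
qed

fun left_inverse_coeff :: "'a::comm_ring_1 fps \<Rightarrow> nat \<Rightarrow> 'a" where
  "left_inverse_coeff f n =
     fps_nth fps_X n - (\<Sum>i<n. left_inverse_coeff f i * fps_nth (f ^ i) n)"

declare left_inverse_coeff.simps [simp del]

lemma left_inverse_exists:
  fixes f :: "'a::comm_ring_1 fps"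
  assumes "fps_nth f 0 = 0" and "fps_nth f 1 = 1"
  shows "\<exists>g. fps_nth g 0 = 0 \<and> fps_nth g 1 = 1 \<and> g oo f = fps_X"
proof (intro exI conjI fps_ext)
  let ?g = "Abs_fps (left_inverse_coeff f)"
  fix n
  have "fps_nth (?g oo f) n = (\<Sum>i<n. left_inverse_coeff f i * fps_nth (f ^ i) n)
      + left_inverse_coeff f n * fps_nth (f ^ n) n"
    by (simp add: fps_compose_nth atLeast0AtMost flip: lessThan_Suc_atMost)
  also have "fps_nth (f ^ n) n = 1"
    using assms by (simp add: startsby_zero_power_nth_same)
  finally show "fps_nth (?g oo f) n = fps_nth fps_X n"
    by (simp add: left_inverse_coeff.simps[of f n])
  show "fps_nth ?g 0 = 0" by (simp add: left_inverse_coeff.simps[of f 0])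
  thus "fps_nth ?g 1 = 1" by (simp add: left_inverse_coeff.simps[of f "Suc 0"])
qed

lemma comp_inverse_exists_unique:
  fixes f :: "'a::comm_ring_1 fps"
  assumes f: "fps_nth f 0 = 0" "fps_nth f 1 = 1"
  shows "\<exists>!g. fps_nth g 0 = 0 \<and> f oo g = fps_X \<and> g oo f = fps_X"
proof -
  obtain g where g: "fps_nth g 0 = 0" "fps_nth g 1 = 1" "g oo f = fps_X"
    using left_inverse_exists[OF f] by blast
  obtain k where k: "fps_nth k 0 = 0" "k oo g = fps_X"
    using left_inverse_exists[OF g(1,2)] by blast
  have "k = f"
    using fps_compose_assoc_comm_ring[OF g(1) f(1), of k] g k f by simp
  hence fg: "f oo g = fps_X" using k by simp
  show ?thesis
  proof (rule ex1I[of _ g])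
    show "fps_nth g 0 = 0 \<and> f oo g = fps_X \<and> g oo f = fps_X" using g fg by blast
    fix h assume h: "fps_nth h 0 = 0 \<and> f oo h = fps_X \<and> h oo f = fps_X"
    show "h = g"
      using fps_compose_assoc_comm_ring[OF f(1) g(1), of h] h g fg by simp
  qed
qed

text \<open>
  A series in \<open>x\<close> and \<open>y\<close> is a series in \<open>y\<close> with coefficients in the series in \<open>x\<close>; the
  coefficient of \<open>x\<^sup>i y\<^sup>j\<close> in \<open>G\<close> is \<open>fps_nth (fps_nth G j) i\<close>.
\<close>

definition in_x :: "'a::zero fps \<Rightarrow> 'a fps fps" where
  "in_x f = fps_const f"

definition in_y :: "'a::zero fps \<Rightarrow> 'a fps fps" where
  "in_y f = Abs_fps (\<lambda>j. fps_const (fps_nth f j))"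

text \<open>
  Substitution of a series \<open>G\<close> in \<open>x\<close> and \<open>y\<close> without constant term into a series in one variable.
  Only terms with \<open>k \<le> i + j\<close> contribute to the coefficient of \<open>x\<^sup>i y\<^sup>j\<close>. The operation \<open>oo\<close> cannot
  be used here, as it truncates with respect to the degree in \<open>y\<close> alone.
\<close>

definition compose_xy :: "'a::comm_ring_1 fps \<Rightarrow> 'a fps fps \<Rightarrow> 'a fps fps" where
  "compose_xy h G =
     Abs_fps (\<lambda>j. Abs_fps (\<lambda>i. \<Sum>k\<le>i + j. fps_nth h k * fps_nth (fps_nth (G ^ k) j) i))"

definition group_law_of_log :: "'a::comm_ring_1 fps \<Rightarrow> 'a fps fps" where
  "group_law_of_log f = compose_xy (comp_inverse f) (in_x f + in_y f)"


section \<open>The formal group law of a Laurent polynomial\<close>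

definition log_series ::
    "('a::{comm_ring_1, ring_char_0}, 'm::finite) laurent_poly \<Rightarrow> int ^ 'm \<Rightarrow> 'a tensor_rat fps" where
  "log_series V w =
     Abs_fps (\<lambda>n. if n = 0 then 0 else tensor (central_coeff V w (n - 1)) (1 / of_nat n))"

definition F_law ::
    "('a::{comm_ring_1, ring_char_0}, 'm::finite) laurent_poly \<Rightarrow> int ^ 'm \<Rightarrow> 'a tensor_rat fps fps" where
  "F_law V w = group_law_of_log (log_series V w)"

lemma log_series_normalized:
  "fps_nth (log_series V w) 0 = 0" "fps_nth (log_series V w) 1 = 1"
  by (simp_all add: log_series_def central_coeff_def lookup_one of_base_def[symmetric]
      of_base_tfrac one_tensor_rat_tfrac)

end

theory Submission
  imports Defs
begin

text \<open>
  Write \<open>\<beta>(n)\<close> for \<open>b\<close> at \<open>n - 1\<close>, and let \<open>\<Phi>\<close> be the Frobenius lift on Laurent polynomials that applies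
  \<open>\<sigma>\<close> to the coefficients and raises the variables to the \<open>p\<close>-th power. Define \<open>D\<^sub>s\<close> recursively by
  \<open>V ^ (p\<^sup>s - 1) = (\<Sum>j=1..s. D\<^sub>j \<Phi>\<^sup>j(V ^ (p ^ (s - j) - 1)))\<close>. Because
  \<open>V ^ (k p\<^sup>s) \<equiv> \<Phi>\<^sup>j(V ^ (k p ^ (s - j)))\<close> modulo \<open>p ^ (s - j + 1)\<close>, one finds inductively that
  \<open>D\<^sub>j\<close> is divisible by \<open>p ^ (j - 1)\<close> and that the same expansion, with \<open>m p ^ i\<close> in place of every \<open>p ^ i\<close>,
  holds modulo \<open>p\<^sup>s\<close>. As \<open>D\<^sub>j\<close> is supported in \<open>(p\<^sup>j - 1) \<Delta>(V)\<close> and \<open>w\<close> is the only interior lattice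
  point, comparing coefficients of \<open>x ^ ((m p\<^sup>s - 1) w)\<close> gives
  \<open>\<beta>(m p\<^sup>s) \<equiv> (\<Sum>j=1..s. p ^ (j - 1) c\<^sub>j \<sigma>\<^sup>j(\<beta>(m p ^ (s - j))))\<close> modulo \<open>p\<^sup>s\<close>.

  So \<open>f - (\<Sum>j\<ge>1. (c\<^sub>j / p) \<sigma>\<^sup>j(f)(x ^ p\<^sup>j))\<close> is \<open>p\<close>-integral, and Hazewinkel's functional equation lemma
  applies, for series in one variable \<open>t\<close> over the power series in \<open>x\<close>: there \<open>F\<^sub>V(xt, t)\<close> is the
  series whose composition with \<open>f\<close> is \<open>f(xt) + f(t)\<close>.
\<close>

section \<open>Congruences modulo prime powers in a ring with a Frobenius lift\<close>

text \<open>The inner binomial coefficients are divisible by \<open>p\<close>. The quotient is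
  written out so that it visibly lies in every subring containing \<open>a\<close> and
  \<open>b\<close>.\<close>

lemma freshman_binomial:
  fixes a b :: "'a::comm_ring_1"
  assumes "prime p"
  shows "(a + b) ^ p - a ^ p - b ^ p
    = of_nat p * (\<Sum>k\<in>{0<..<p}. of_nat ((p choose k) div p) * a ^ k * b ^ (p - k))"
proof -
  have p: "p > 0" using assms prime_gt_0_nat by blast
  have "{..p} = insert 0 (insert p {0<..<p})" using p by auto
  hence "(a + b) ^ p = b ^ p + (a ^ p + (\<Sum>k\<in>{0<..<p}. of_nat (p choose k) * a ^ k * b ^ (p - k)))"
    using p by (simp add: binomial_ring)
  also have "(\<Sum>k\<in>{0<..<p}. of_nat (p choose k) * a ^ k * b ^ (p - k))
      = (\<Sum>k\<in>{0<..<p}. of_nat p * (of_nat ((p choose k) div p) * a ^ k * b ^ (p - k)))"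
  proof (rule sum.cong)
    fix k assume "k \<in> {0<..<p}"
    hence "p dvd (p choose k)" using assms by (intro dvd_choose_prime) auto
    hence "p choose k = p * ((p choose k) div p)" by simp
    hence "(of_nat (p choose k) :: 'a) = of_nat p * of_nat ((p choose k) div p)"
      by (metis of_nat_mult)
    thus "of_nat (p choose k) * a ^ k * b ^ (p - k)
        = of_nat p * (of_nat ((p choose k) div p) * a ^ k * b ^ (p - k))"
      by (simp add: mult.assoc)
  qed simp
  finally show ?thesis by (simp add: sum_distrib_left)
qed

lemma ring_endomorphism_simps:
  assumes "ring_endomorphism \<phi>"
  shows "\<phi> 0 = 0" "\<phi> 1 = 1" "\<phi> (a + b) = \<phi> a + \<phi> b" "\<phi> (a * b) = \<phi> a * \<phi> b"
    "\<phi> (- a) = - \<phi> a" "\<phi> (a - b) = \<phi> a - \<phi> b" "\<phi> (a ^ n) = \<phi> a ^ n"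
    "\<phi> (of_nat n) = of_nat n" "\<phi> (sum h X) = (\<Sum>x\<in>X. \<phi> (h x))"
proof -
  show one: "\<phi> 1 = 1" and add: "\<And>a b. \<phi> (a + b) = \<phi> a + \<phi> b"
    and mult: "\<And>a b. \<phi> (a * b) = \<phi> a * \<phi> b"
    using assms by (auto simp: ring_endomorphism_def)
  show zero: "\<phi> 0 = 0" using add[of 0 0] by simp
  have minus: "\<phi> (- a) = - \<phi> a" for a
    using add[of a "- a"] zero by (simp add: add_eq_0_iff2)
  thus "\<phi> (- a) = - \<phi> a" .
  show "\<phi> (a - b) = \<phi> a - \<phi> b" using add[of a "- b"] minus[of b] by simp
  show "\<phi> (a ^ n) = \<phi> a ^ n" by (induction n) (simp_all add: one mult)
  show "\<phi> (of_nat n) = of_nat n" by (induction n) (simp_all add: one add zero)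
  show "\<phi> (sum h X) = (\<Sum>x\<in>X. \<phi> (h x))"
    by (induction X rule: infinite_finite_induct) (simp_all add: zero add)
qed

lemma ring_endomorphism_funpow:
  "ring_endomorphism \<phi> \<Longrightarrow> ring_endomorphism (\<phi> ^^ n)"
  by (induction n) (simp_all add: ring_endomorphism_def)

text \<open>\<open>\<phi>\<close> acts on the whole ring, but the Frobenius congruence is required
  only on the subring \<open>A\<close>. This fits \<open>R \<otimes> \<rat>\<close> with
  \<open>A\<close> the \<open>p\<close>-integral elements: the logarithm has coefficients outside
  \<open>A\<close> to which \<open>\<phi>\<close> must still apply.\<close>

locale frobenius_subring =
  fixes p :: nat and A :: "'a::comm_ring_1 set" and \<phi> :: "'a \<Rightarrow> 'a"
  assumes prime: "prime p"
    and one_closed: "1 \<in> A"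
    and diff_closed: "a \<in> A \<Longrightarrow> b \<in> A \<Longrightarrow> a - b \<in> A"
    and mult_closed: "a \<in> A \<Longrightarrow> b \<in> A \<Longrightarrow> a * b \<in> A"
    and endo: "ring_endomorphism \<phi>"
    and frob_closed: "a \<in> A \<Longrightarrow> \<phi> a \<in> A"
    and frob: "a \<in> A \<Longrightarrow> \<exists>c\<in>A. \<phi> a - a ^ p = of_nat p * c"
begin

lemmas endo_simps = ring_endomorphism_simps[OF endo]
lemmas endo_funpow_simps = ring_endomorphism_simps[OF ring_endomorphism_funpow[OF endo]]

lemma zero_closed: "0 \<in> A"
  using diff_closed[OF one_closed one_closed] by simp

lemma uminus_closed: "a \<in> A \<Longrightarrow> - a \<in> A"
  using diff_closed[OF zero_closed] by fastforce

lemma add_closed: "a \<in> A \<Longrightarrow> b \<in> A \<Longrightarrow> a + b \<in> A"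
  using diff_closed[OF _ uminus_closed] by fastforce

lemma of_nat_closed: "of_nat n \<in> A"
  by (induction n) (auto intro: zero_closed one_closed add_closed)

lemma power_closed: "a \<in> A \<Longrightarrow> a ^ n \<in> A"
  by (induction n) (auto intro: one_closed mult_closed)

lemma sum_closed: "(\<And>x. x \<in> X \<Longrightarrow> h x \<in> A) \<Longrightarrow> sum h X \<in> A"
  by (induction X rule: infinite_finite_induct) (auto intro: zero_closed add_closed)

lemma funpow_closed: "a \<in> A \<Longrightarrow> (\<phi> ^^ j) a \<in> A"
  by (induction j) (auto intro: frob_closed)

text \<open>The quotient must lie in \<open>A\<close>: where \<open>p\<close> is invertible in the
  ambient ring, divisibility there would be an empty condition.\<close>

definition pcong :: "nat \<Rightarrow> 'a \<Rightarrow> 'a \<Rightarrow> bool" where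
  "pcong n a b \<longleftrightarrow> (\<exists>c\<in>A. a - b = of_nat (p ^ n) * c)"

lemma pcongI: "c \<in> A \<Longrightarrow> a - b = of_nat (p ^ n) * c \<Longrightarrow> pcong n a b"
  unfolding pcong_def by blast

lemma pcong_refl [simp]: "pcong n a a"
  by (rule pcongI[OF zero_closed]) simp

lemma pcong_sym: "pcong n a b \<Longrightarrow> pcong n b a"
  unfolding pcong_def by (metis uminus_closed minus_diff_eq mult_minus_right)

lemma pcong_trans [trans]:
  assumes "pcong n a b" "pcong n b c"
  shows "pcong n a c"
proof -
  obtain x y where "x \<in> A" "y \<in> A" "a - b = of_nat (p ^ n) * x" "b - c = of_nat (p ^ n) * y"
    using assms unfolding pcong_def by blast
  thus ?thesis
    by (intro pcongI[of "x + y"] add_closed) (simp_all add: algebra_simps del: of_nat_power)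
qed

lemma pcong_add:
  assumes "pcong n a b" "pcong n c d"
  shows "pcong n (a + c) (b + d)"
proof -
  obtain x y where "x \<in> A" "y \<in> A" "a - b = of_nat (p ^ n) * x" "c - d = of_nat (p ^ n) * y"
    using assms unfolding pcong_def by blast
  thus ?thesis
    by (intro pcongI[of "x + y"] add_closed) (simp_all add: algebra_simps del: of_nat_power)
qed

lemma pcong_sum: "(\<And>x. x \<in> X \<Longrightarrow> pcong n (f x) (g x)) \<Longrightarrow> pcong n (sum f X) (sum g X)"
  by (induction X rule: infinite_finite_induct) (auto intro: pcong_add)

lemma pcong_mult:
  assumes "pcong n a b" "pcong n c d" "b \<in> A" "c \<in> A"
  shows "pcong n (a * c) (b * d)"
proof -
  obtain x y where "x \<in> A" "y \<in> A" and e: "a - b = of_nat (p ^ n) * x" "c - d = of_nat (p ^ n) * y"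
    using assms unfolding pcong_def by blast
  moreover have "a * c - b * d = (a - b) * c + b * (c - d)" by (simp add: algebra_simps)
  ultimately show ?thesis
    unfolding e using assms
    by (intro pcongI[of "x * c + b * y"] add_closed mult_closed) (simp_all add: algebra_simps e del: of_nat_power)
qed

lemma pcong_power:
  assumes "pcong n a b" "a \<in> A" "b \<in> A"
  shows "pcong n (a ^ k) (b ^ k)"
  by (induction k) (auto intro: pcong_mult assms power_closed)

lemma pcong_mult_dvd:
  assumes "pcong n a b" "d = of_nat (p ^ m) * e" "e \<in> A"
  shows "pcong (m + n) (d * a) (d * b)"
proof -
  obtain x where "x \<in> A" and e: "a - b = of_nat (p ^ n) * x"
    using assms unfolding pcong_def by blast
  moreover have "d * a - d * b = d * (a - b)" by (simp add: algebra_simps)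
  ultimately show ?thesis
    using assms
    by (intro pcongI[of "e * x"] mult_closed) (simp_all add: algebra_simps power_add)
qed

lemma pcong_mono:
  assumes "pcong n a b" "m \<le> n"
  shows "pcong m a b"
proof -
  obtain x where "x \<in> A" and e: "a - b = of_nat (p ^ n) * x"
    using assms unfolding pcong_def by blast
  moreover have "p ^ n = p ^ m * p ^ (n - m)" using assms(2) by (simp flip: power_add)
  ultimately show ?thesis
    by (intro pcongI[of "of_nat (p ^ (n - m)) * x"] mult_closed of_nat_closed) (simp_all add: mult.assoc)
qed

lemma pcong_frob:
  assumes "pcong n a b"
  shows "pcong n (\<phi> a) (\<phi> b)"
proof -
  obtain x where "x \<in> A" and e: "a - b = of_nat (p ^ n) * x"
    using assms unfolding pcong_def by blast
  hence "\<phi> (a - b) = of_nat (p ^ n) * \<phi> x" by (simp only: endo_simps)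
  with \<open>x \<in> A\<close> show ?thesis
    by (intro pcongI[of "\<phi> x"] frob_closed) (simp_all add: endo_simps)
qed

text \<open>In the factorisation of \<open>a ^ p - b ^ p\<close>, the cofactor of
  \<open>a - b\<close> is congruent to \<open>p * b ^ (p - 1)\<close>, hence to 0, modulo
  \<open>p\<close>. This uses \<open>a\<close> congruent to \<open>b\<close> modulo
  \<open>p\<close>, so the exponent starts at \<open>Suc n\<close>.\<close>

lemma pcong_power_prime:
  assumes "pcong (Suc n) a b" "a \<in> A" "b \<in> A"
  shows "pcong (Suc (Suc n)) (a ^ p) (b ^ p)"
proof -
  obtain x where x: "x \<in> A" "a - b = of_nat (p ^ Suc n) * x"
    using assms unfolding pcong_def by blast
  have "pcong 1 (b ^ (p - Suc i) * a ^ i) (b ^ (p - 1))" if "i < p" for i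
  proof -
    have "pcong 1 (b ^ (p - Suc i) * a ^ i) (b ^ (p - Suc i) * b ^ i)"
      using assms pcong_mono[OF assms(1)] by (intro pcong_mult pcong_power power_closed) auto
    thus ?thesis using that by (simp flip: power_add)
  qed
  hence "pcong 1 (\<Sum>i<p. b ^ (p - Suc i) * a ^ i) (\<Sum>i<p. b ^ (p - 1))"
    by (intro pcong_sum) auto
  moreover have "pcong 1 (\<Sum>i<p. b ^ (p - 1)) 0"
    using assms by (intro pcongI[of "b ^ (p - 1)"] power_closed) auto
  ultimately have "pcong 1 (\<Sum>i<p. b ^ (p - Suc i) * a ^ i) 0"
    by (rule pcong_trans)
  then obtain y where y: "y \<in> A" "(\<Sum>i<p. b ^ (p - Suc i) * a ^ i) = of_nat p * y"
    unfolding pcong_def by auto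
  have "a ^ p - b ^ p = (a - b) * (\<Sum>i<p. b ^ (p - Suc i) * a ^ i)"
    by (rule power_diff_sumr2)
  also have "\<dots> = of_nat (p ^ Suc (Suc n)) * (x * y)"
    unfolding x y by (simp add: algebra_simps)
  finally show ?thesis using x y by (intro pcongI[of "x * y"] mult_closed)
qed

lemma pcong_power_prime_power:
  assumes "pcong 1 a b" "a \<in> A" "b \<in> A"
  shows "pcong (Suc v) (a ^ p ^ v) (b ^ p ^ v)"
proof (induction v)
  case (Suc v)
  have "pcong (Suc (Suc v)) ((a ^ p ^ v) ^ p) ((b ^ p ^ v) ^ p)"
    using assms by (intro pcong_power_prime Suc power_closed)
  thus ?case by (simp add: mult.commute flip: power_mult)
qed (use assms in simp)

text \<open>Raising the congruence of \<open>a ^ p\<close> and \<open>\<phi> a\<close> modulo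
  \<open>p\<close> to the power \<open>p ^ v\<close> gives a congruence modulo
  \<open>p ^ (v + 1)\<close>. Each induction step trades one factor \<open>p\<close> of the exponent
  for one application of \<open>\<phi>\<close>, and \<open>p ^ v\<close> still divides what
  remains.\<close>

lemma pcong_frob_power:
  assumes "a \<in> A" "p ^ v dvd k"
  shows "pcong (Suc v) (a ^ (k * p ^ j)) ((\<phi> ^^ j) (a ^ k))"
proof (induction j)
  case (Suc j)
  let ?N = "k * p ^ j"
  obtain m where m: "?N = p ^ v * m" using assms(2) by (metis dvd_mult2 dvd_def)
  have 1: "pcong 1 (a ^ p) (\<phi> a)"
    using frob[OF assms(1)] by (intro pcong_sym[of _ "\<phi> a"]) (simp add: pcong_def)
  have "pcong (Suc v) (((a ^ p) ^ p ^ v) ^ m) ((\<phi> a ^ p ^ v) ^ m)"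
    by (intro pcong_power pcong_power_prime_power 1 power_closed frob_closed assms)
  hence "pcong (Suc v) (a ^ (p * ?N)) (\<phi> (a ^ ?N))"
    by (simp add: m endo_simps flip: power_mult) (simp add: mult_ac)
  also have "pcong (Suc v) (\<phi> (a ^ ?N)) (\<phi> ((\<phi> ^^ j) (a ^ k)))"
    by (rule pcong_frob) (rule Suc)
  finally show ?case by (simp add: mult_ac)
qed simp

end

section \<open>Frobenius lifts on power series\<close>

text \<open>Stated outside the locale because it serves to establish the congruence for new rings:
  it need only be checked on monomials and then spreads to finite sums.\<close>

lemma frobenius_congruence_add:
  fixes \<phi> :: "'a::comm_ring_1 \<Rightarrow> 'a"
  assumes "prime p" "1 \<in> A"
    and diff: "\<And>a b. a \<in> A \<Longrightarrow> b \<in> A \<Longrightarrow> a - b \<in> A"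
    and mult: "\<And>a b. a \<in> A \<Longrightarrow> b \<in> A \<Longrightarrow> a * b \<in> A"
    and add: "\<phi> (a + b) = \<phi> a + \<phi> b"
    and a: "a \<in> A" "\<exists>c\<in>A. \<phi> a - a ^ p = of_nat p * c"
    and b: "b \<in> A" "\<exists>c\<in>A. \<phi> b - b ^ p = of_nat p * c"
  shows "\<exists>c\<in>A. \<phi> (a + b) - (a + b) ^ p = of_nat p * c"
proof -
  have zero: "0 \<in> A" using diff[of 1 1] assms(2) by simp
  have plus: "x + y \<in> A" if "x \<in> A" "y \<in> A" for x y
    using diff[OF that(1) diff[OF zero that(2)]] by simp
  have nat: "of_nat n \<in> A" for n by (induction n) (auto intro: zero plus assms(2))
  have pow: "x ^ n \<in> A" if "x \<in> A" for x n by (induction n) (auto intro: mult that assms(2))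
  let ?e = "\<Sum>k\<in>{0<..<p}. of_nat ((p choose k) div p) * a ^ k * b ^ (p - k)"
  have e: "sum h X \<in> A" if "\<And>x. x \<in> X \<Longrightarrow> h x \<in> A" for h and X :: "nat set"
    using that by (induction X rule: infinite_finite_induct) (auto intro: zero plus)
  obtain c d where cd: "c \<in> A" "\<phi> a - a ^ p = of_nat p * c" "d \<in> A" "\<phi> b - b ^ p = of_nat p * d"
    using a b by blast
  have "\<phi> (a + b) - (a + b) ^ p
      = (\<phi> a - a ^ p) + (\<phi> b - b ^ p) - ((a + b) ^ p - a ^ p - b ^ p)"
    by (simp add: add)
  also have "\<dots> = of_nat p * (c + d - ?e)"
    unfolding cd freshman_binomial[OF assms(1)] by (simp add: algebra_simps)
  finally show ?thesis
    using cd by (intro bexI[of _ "c + d - ?e"] diff plus e mult nat pow a b)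
qed

text \<open>\<open>\<phi>\<close> on the coefficients combined with the substitution of
  \<open>t ^ p\<close> for \<open>t\<close>.\<close>

definition fps_frob :: "nat \<Rightarrow> ('a::zero \<Rightarrow> 'a) \<Rightarrow> 'a fps \<Rightarrow> 'a fps" where
  "fps_frob p \<phi> G = Abs_fps (\<lambda>n. if p dvd n then \<phi> (fps_nth G (n div p)) else 0)"

lemma fps_frob_nth:
  "fps_nth (fps_frob p \<phi> G) n = (if p dvd n then \<phi> (fps_nth G (n div p)) else 0)"
  by (simp add: fps_frob_def)

lemma fps_frob_nth_mult:
  "p > 0 \<Longrightarrow> fps_nth (fps_frob p \<phi> G) (p * n) = \<phi> (fps_nth G n)"
  by (simp add: fps_frob_nth)

lemma funpow_fps_frob_nth:
  assumes "p > 0" "\<phi> 0 = 0"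
  shows "fps_nth ((fps_frob p \<phi> ^^ j) G) n
    = (if p ^ j dvd n then (\<phi> ^^ j) (fps_nth G (n div p ^ j)) else 0)"
proof (induction j arbitrary: n)
  case (Suc j)
  have "p * p ^ j dvd n \<longleftrightarrow> p dvd n \<and> p ^ j dvd n div p"
    using assms(1) by (metis dvd_div_iff_mult dvd_mult_left mult.commute neq0_conv)
  moreover have "n div p div p ^ j = n div (p * p ^ j)"
    by (simp add: div_mult2_eq)
  ultimately show ?case by (simp add: fps_frob_nth Suc assms(2))
qed simp

lemma ring_endomorphism_fps_frob:
  assumes "p > 0" and \<phi>: "ring_endomorphism \<phi>"
  shows "ring_endomorphism (fps_frob p \<phi>)"
  unfolding ring_endomorphism_def
proof (intro conjI allI)
  note s = ring_endomorphism_simps[OF \<phi>]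
  show "fps_frob p \<phi> 1 = 1"
    using assms by (intro fps_ext) (auto simp: fps_frob_nth s)
  fix G H :: "'a fps"
  show "fps_frob p \<phi> (G + H) = fps_frob p \<phi> G + fps_frob p \<phi> H"
    by (intro fps_ext) (simp add: fps_frob_nth s)
  show "fps_frob p \<phi> (G * H) = fps_frob p \<phi> G * fps_frob p \<phi> H"
  proof (rule fps_ext)
    fix n
    let ?t = "\<lambda>i. fps_nth (fps_frob p \<phi> G) i * fps_nth (fps_frob p \<phi> H) (n - i)"
    show "fps_nth (fps_frob p \<phi> (G * H)) n = fps_nth (fps_frob p \<phi> G * fps_frob p \<phi> H) n"
    proof (cases "p dvd n")
      case True
      then obtain m where n: "n = p * m" by blast
      have "sum ?t {0..n} = sum ?t ((\<lambda>i. p * i) ` {0..m})"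
      proof (rule sum.mono_neutral_right)
        show "(\<lambda>i. p * i) ` {0..m} \<subseteq> {0..n}" using n by auto
        show "\<forall>i\<in>{0..n} - (\<lambda>i. p * i) ` {0..m}. ?t i = 0"
        proof
          fix i assume "i \<in> {0..n} - (\<lambda>i. p * i) ` {0..m}"
          hence "\<not> p dvd i" using n assms(1) by (auto elim!: dvdE)
          thus "?t i = 0" by (simp add: fps_frob_nth)
        qed
      qed simp
      also have "\<dots> = (\<Sum>i=0..m. ?t (p * i))"
        using assms(1) by (subst sum.reindex) (auto simp: inj_on_def)
      also have "\<dots> = (\<Sum>i=0..m. \<phi> (fps_nth G i) * \<phi> (fps_nth H (m - i)))"
        using assms(1) by (simp add: n fps_frob_nth_mult flip: diff_mult_distrib2)
      finally show ?thesis
        using assms(1) by (simp add: n fps_frob_nth_mult fps_mult_nth s)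
    next
      case False
      \<comment> \<open>\<open>i\<close> and \<open>n - i\<close> cannot both be multiples of
        \<open>p\<close>.\<close>
      hence "?t i = 0" if "i \<le> n" for i
        using that by (auto simp: fps_frob_nth) (metis dvd_diffD)
      thus ?thesis using False by (simp add: fps_frob_nth fps_mult_nth)
    qed
  qed
qed

definition fps_over :: "'a::zero set \<Rightarrow> 'a fps set" where
  "fps_over A = {G. \<forall>n. fps_nth G n \<in> A}"

lemma fps_power_nth_cong:
  fixes G H :: "'a::comm_ring_1 fps"
  assumes "\<And>i. i \<le> n \<Longrightarrow> fps_nth G i = fps_nth H i" "m \<le> n"
  shows "fps_nth (G ^ k) m = fps_nth (H ^ k) m"
  using assms(2) by (induction k arbitrary: m) (auto simp: fps_mult_nth assms(1) intro!: sum.cong)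

context frobenius_subring
begin

lemma fps_over_one: "1 \<in> fps_over A"
  by (auto simp: fps_over_def zero_closed one_closed)

lemma fps_over_diff: "G \<in> fps_over A \<Longrightarrow> H \<in> fps_over A \<Longrightarrow> G - H \<in> fps_over A"
  by (auto simp: fps_over_def diff_closed)

lemma fps_over_mult: "G \<in> fps_over A \<Longrightarrow> H \<in> fps_over A \<Longrightarrow> G * H \<in> fps_over A"
  by (auto simp: fps_over_def fps_mult_nth intro!: sum_closed mult_closed)

lemma fps_over_monomial: "a \<in> A \<Longrightarrow> fps_const a * fps_X ^ i \<in> fps_over A"
  by (auto simp: fps_over_def zero_closed)

lemma prime_pos: "p > 0"
  using prime prime_gt_0_nat by blast

text \<open>Additivity of the congruence reaches only finite sums, hence the restriction to
  truncations of \<open>G\<close>.\<close>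

lemma fps_frob_polynomial:
  assumes "G \<in> fps_over A"
  defines "T \<equiv> \<lambda>n. (\<Sum>i<n. fps_const (fps_nth G i) * fps_X ^ i)"
  shows "T n \<in> fps_over A \<and> (\<exists>C\<in>fps_over A. fps_frob p \<phi> (T n) - T n ^ p = of_nat p * C)"
proof (induction n)
  case 0
  have "(0 :: 'a fps) \<in> fps_over A" by (auto simp: fps_over_def zero_closed)
  moreover have "fps_frob p \<phi> 0 = 0" by (rule fps_ext) (simp add: fps_frob_nth endo_simps)
  ultimately show ?case
    using prime_pos by (auto simp: T_def zero_power intro!: bexI[of _ 0])
next
  case (Suc n)
  let ?a = "fps_nth G n"
  let ?M = "fps_const ?a * fps_X ^ n"
  have a: "?a \<in> A" using assms(1) by (simp add: fps_over_def)
  have M: "?M \<in> fps_over A" by (rule fps_over_monomial[OF a])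
  have Tn: "T (Suc n) = T n + ?M" by (simp add: T_def)
  obtain c where c: "c \<in> A" "\<phi> ?a - ?a ^ p = of_nat p * c" using frob[OF a] by blast
  have "fps_frob p \<phi> ?M = fps_const (\<phi> ?a) * fps_X ^ (p * n)"
    by (rule fps_ext) (use prime_pos in \<open>auto simp: fps_frob_nth endo_simps\<close>)
  also have "\<dots> - ?M ^ p = fps_const (\<phi> ?a - ?a ^ p) * fps_X ^ (p * n)"
    by (simp add: power_mult_distrib algebra_simps flip: power_mult fps_const_sub)
  also have "\<dots> = of_nat p * (fps_const c * fps_X ^ (p * n))"
    unfolding c by (simp add: mult.assoc fps_of_nat flip: fps_const_mult)
  finally have Mc: "\<exists>C\<in>fps_over A. fps_frob p \<phi> ?M - ?M ^ p = of_nat p * C"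
    using fps_over_monomial[OF c(1)] by blast
  have "T n + ?M \<in> fps_over A"
    using Suc M by (auto simp only: fps_over_def fps_add_nth mem_Collect_eq intro!: add_closed)
  moreover have "fps_frob p \<phi> (T n + ?M) = fps_frob p \<phi> (T n) + fps_frob p \<phi> ?M"
    using ring_endomorphism_fps_frob[OF prime_pos endo] by (simp add: ring_endomorphism_def)
  ultimately show ?case
    unfolding Tn using Suc M Mc
    by (intro conjI frobenius_congruence_add[OF prime fps_over_one fps_over_diff fps_over_mult, where a = "T n" and b = ?M])
      simp_all
qed

text \<open>The coefficients of degree \<open>n\<close> of \<open>fps_frob p \<phi> G\<close> and of
  \<open>G ^ p\<close> depend only on the coefficients of \<open>G\<close> up to degree
  \<open>n\<close>, so the truncation \<open>T\<close> decides each degree. The quotients found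
  degree by degree form one series.\<close>

lemma frobenius_subring_fps: "frobenius_subring p (fps_over A) (fps_frob p \<phi>)"
proof
  show "prime p" by (rule prime)
  show "1 \<in> fps_over A" by (rule fps_over_one)
  show "ring_endomorphism (fps_frob p \<phi>)"
    by (rule ring_endomorphism_fps_frob[OF prime_pos endo])
  fix G assume G: "G \<in> fps_over A"
  show "fps_frob p \<phi> G \<in> fps_over A"
    using G by (auto simp: fps_over_def fps_frob_nth intro: frob_closed zero_closed)
  have "\<exists>c\<in>A. fps_nth (fps_frob p \<phi> G - G ^ p) n = of_nat p * c" for n
  proof -
    define T where "T = (\<Sum>i<Suc n. fps_const (fps_nth G i) * fps_X ^ i)"
    have T: "fps_nth T i = fps_nth G i" if "i \<le> n" for i
    proof -
      have "fps_nth T i = (\<Sum>k<Suc n. if i = k then fps_nth G k else 0)"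
        unfolding T_def fps_sum_nth by (rule sum.cong) auto
      thus ?thesis using that by (simp del: sum.lessThan_Suc)
    qed
    obtain C where C: "C \<in> fps_over A" "fps_frob p \<phi> T - T ^ p = of_nat p * C"
      using fps_frob_polynomial[OF G, of "Suc n"] unfolding T_def by blast
    have "fps_nth (fps_frob p \<phi> G) n = fps_nth (fps_frob p \<phi> T) n"
      by (simp add: fps_frob_nth T)
    moreover have "fps_nth (G ^ p) n = fps_nth (T ^ p) n"
      by (rule fps_power_nth_cong[of n]) (simp_all add: T)
    ultimately have "fps_nth (fps_frob p \<phi> G - G ^ p) n = fps_nth (of_nat p * C) n"
      by (simp flip: C(2))
    also have "\<dots> = of_nat p * fps_nth C n"
      by (simp flip: fps_of_nat)
    finally show ?thesis using C(1) by (auto simp: fps_over_def)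
  qed
  then obtain c where "\<And>n. c n \<in> A" "\<And>n. fps_nth (fps_frob p \<phi> G - G ^ p) n = of_nat p * c n"
    by metis
  thus "\<exists>C\<in>fps_over A. fps_frob p \<phi> G - G ^ p = of_nat p * C"
    by (intro bexI[of _ "Abs_fps c"] fps_ext) (auto simp: fps_over_def simp flip: fps_of_nat)
qed (auto intro: fps_over_diff fps_over_mult)

end

section \<open>The functional equation lemma\<close>

text \<open>In the product of \<open>F\<close> and \<open>F ^ (k - 1)\<close>, the top coefficient
  of either factor meets the constant term of the other, which is 0.\<close>

lemma fps_power_nth_drop_top:
  fixes F F' :: "'a::comm_ring_1 fps"
  assumes "\<And>i. i < n \<Longrightarrow> fps_nth F i = fps_nth F' i" "fps_nth F 0 = 0" "n \<ge> 1" "k \<ge> 2"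
  shows "fps_nth (F ^ k) n = fps_nth (F' ^ k) n"
proof -
  obtain l where k: "k = Suc l" "l \<ge> 1" using assms(4) by (cases k) auto
  have F': "fps_nth F' 0 = 0" using assms(1)[of 0] assms(2,3) by simp
  have z: "fps_nth (F ^ l) 0 = 0" "fps_nth (F' ^ l) 0 = 0"
    using k(2) assms(2) F' by (simp_all add: fps_nth_power_0 zero_power)
  have "fps_nth F i * fps_nth (F ^ l) (n - i) = fps_nth F' i * fps_nth (F' ^ l) (n - i)"
    if i: "i \<le> n" for i
  proof -
    consider "i = 0" | "i = n" | "0 < i" "i < n" using i by linarith
    thus ?thesis
    proof cases
      case 3
      have "fps_nth (F ^ l) (n - i) = fps_nth (F' ^ l) (n - i)"
        using 3 by (intro fps_power_nth_cong[of "n - 1"] assms(1)) auto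
      thus ?thesis using 3 assms(1) by simp
    qed (simp_all add: z F' assms(2))
  qed
  thus ?thesis unfolding k(1) by (simp add: fps_mult_nth)
qed

context frobenius_subring
begin

text \<open>
  Hazewinkel's functional equation \<open>G - (\<Sum>j\<ge>1. s\<^sub>j \<phi>\<^sup>j(G)(t ^ p\<^sup>j)) \<in> A[[t]]\<close>.
  The sum is cut off at \<open>j = n\<close> because \<open>j < p\<^sup>j\<close>.
\<close>

definition hazewinkel :: "(nat \<Rightarrow> 'a) \<Rightarrow> 'a fps \<Rightarrow> bool" where
  "hazewinkel s G \<longleftrightarrow> (\<forall>n>0. fps_nth G n
     - (\<Sum>j=1..n. s j * fps_nth ((fps_frob p \<phi> ^^ j) G) n) \<in> A)"

lemma funpow_fps_frob_nth':
  "fps_nth ((fps_frob p \<phi> ^^ j) G) n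
    = (if p ^ j dvd n then (\<phi> ^^ j) (fps_nth G (n div p ^ j)) else 0)"
  using prime_pos endo_simps by (intro funpow_fps_frob_nth)

lemma less_prime_power: "j < p ^ j"
proof -
  have "j < 2 ^ j" by (rule less_exp)
  also have "\<dots> \<le> p ^ j" using prime_ge_2_nat[OF prime] by (intro power_mono) auto
  finally show ?thesis .
qed

text \<open>The terms with \<open>j > n\<close> vanish since \<open>p ^ j > n\<close>. This allows
  one cut-off for all degrees up to \<open>N\<close>.\<close>

lemma hazewinkel_bound:
  assumes "hazewinkel s G" "n > 0" "n \<le> N"
  shows "fps_nth G n - (\<Sum>j=1..N. s j * fps_nth ((fps_frob p \<phi> ^^ j) G) n) \<in> A"
proof -
  have "\<not> p ^ j dvd n" if "j > n" for j
    using less_prime_power[of j] dvd_imp_le[of "p ^ j" n] that assms(2) by linarith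
  hence "(\<Sum>j=1..n. s j * fps_nth ((fps_frob p \<phi> ^^ j) G) n)
      = (\<Sum>j=1..N. s j * fps_nth ((fps_frob p \<phi> ^^ j) G) n)"
    using assms(3) by (intro sum.mono_neutral_left) (auto simp: funpow_fps_frob_nth')
  moreover have "fps_nth G n - (\<Sum>j=1..n. s j * fps_nth ((fps_frob p \<phi> ^^ j) G) n) \<in> A"
    using assms(1,2) unfolding hazewinkel_def by blast
  ultimately show ?thesis by (simp only:)
qed

text \<open>
  In degree \<open>n\<close>, subtracting the functional equations of \<open>f\<close> and \<open>L\<close> leaves \<open>F\<^sub>n\<close> plus terms with
  \<open>F\<^sub>m\<close>, \<open>m < n\<close>: the correction terms involve only the differences of \<open>F ^ (k p\<^sup>j)\<close> and
  \<open>\<phi>\<^sup>j(F\<^sup>k)(t ^ p\<^sup>j)\<close>, whose divisibility by \<open>p k\<close> offsets the denominators of \<open>s\<^sub>j\<close> and \<open>f\<^sub>k\<close>.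
\<close>

theorem functional_equation_lemma:
  assumes f: "hazewinkel s f" "fps_nth f 0 = 0" "fps_nth f 1 = 1"
    and f_den: "\<And>k. k > 0 \<Longrightarrow> of_nat (p ^ multiplicity p k) * fps_nth f k \<in> A"
    and s: "\<And>j. j > 0 \<Longrightarrow> of_nat p * s j \<in> A"
    and L: "hazewinkel s L"
    and F: "fps_nth F 0 = 0" "f oo F = L"
  shows "F \<in> fps_over A"
proof -
  interpret T: frobenius_subring p "fps_over A" "fps_frob p \<phi>"
    by (rule frobenius_subring_fps)
  let ?\<Psi> = "fps_frob p \<phi>"
  have "fps_nth F n \<in> A" for n
  proof (induction n rule: less_induct)
    case (less n)
    show ?case
    proof (cases "n = 0")
      case True
      thus ?thesis using F(1) zero_closed by simp
    next
      case False
      \<comment> \<open>The truncation has all its coefficients in \<open>A\<close> by the induction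
        hypothesis, so the congruences apply to it, which is not yet known for
        \<open>F\<close>.\<close>
      define F' where "F' = Abs_fps (\<lambda>i. if i < n then fps_nth F i else 0)"
      have FF': "fps_nth F i = fps_nth F' i" if "i < n" for i
        using that by (simp add: F'_def)
      have F'A: "F' \<in> fps_over A"
        using less by (auto simp: fps_over_def F'_def zero_closed)
      have pow_low: "fps_nth (F ^ k) i = fps_nth (F' ^ k) i" if "i < n" for i k
        by (rule fps_power_nth_cong[of "n - 1"]) (use that FF' in auto)
      have pow_top: "fps_nth (F ^ k) n = fps_nth (F' ^ k) n" if "k \<ge> 2" for k
        using False that F(1) FF' by (intro fps_power_nth_drop_top) auto
      have F'kA: "fps_nth (F' ^ k) i \<in> A" for k i
        using T.power_closed[OF F'A, of k] by (simp add: fps_over_def)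
      define \<Phi> where "\<Phi> j G = (?\<Psi> ^^ j) G" for j G
      note \<Phi>_nth = funpow_fps_frob_nth'[folded \<Phi>_def]
      have zero_pow: "fps_nth (F ^ k) i = 0" if "k > i" for k i
        using startsby_zero_power_prefix[OF F(1), of k] that by auto
      \<comment> \<open>The summation range is the same for all \<open>i \<le> n\<close>, because
        \<open>rhs\<close> needs the formula at \<open>n div p ^ j\<close>.\<close>
      have compose: "fps_nth L i = (\<Sum>k=1..n. fps_nth f k * fps_nth (F ^ k) i)" if "i \<le> n" for i
      proof -
        have "fps_nth L i = (\<Sum>k\<le>n. fps_nth f k * fps_nth (F ^ k) i)"
          unfolding F(2)[symmetric] by (rule fps_compose_nth_upto[OF F(1) that])
        also have "\<dots> = (\<Sum>k=1..n. fps_nth f k * fps_nth (F ^ k) i)"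
          using f(2) by (intro sum.mono_neutral_right) (auto simp: Suc_le_eq)
        finally show ?thesis .
      qed
      define g where "g k = fps_nth f k - (\<Sum>j=1..n. s j * fps_nth (\<Phi> j f) k)" for k
      have gA: "g k \<in> A" if "k \<in> {1..n}" for k
        using hazewinkel_bound[OF f(1), of k n] that by (simp add: g_def \<Phi>_def)
      have g1: "g 1 = 1"
      proof -
        have "fps_nth (\<Phi> j f) 1 = 0" if "j \<ge> 1" for j
          using that less_prime_power[of j] prime by (auto simp: \<Phi>_nth)
        hence "(\<Sum>j=1..n. s j * fps_nth (\<Phi> j f) 1) = 0" by (intro sum.neutral) auto
        thus ?thesis by (simp add: g_def f(3) del: One_nat_def)
      qed
      have lhs: "(\<Sum>k=1..n. fps_nth (\<Phi> j f) k * fps_nth (F ^ k) n)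
          = (\<Sum>k=1..n. (\<phi> ^^ j) (fps_nth f k) * fps_nth (F ^ (k * p ^ j)) n)" for j
      proof -
        let ?h = "\<lambda>m. fps_nth (\<Phi> j f) m * fps_nth (F ^ m) n"
        have q: "p ^ j > 0" using prime_pos by simp
        \<comment> \<open>Powers \<open>F ^ m\<close> with \<open>m > n\<close> do not reach degree
          \<open>n\<close>, so the range may be enlarged until it contains all
          \<open>k * p ^ j\<close> with \<open>k \<le> n\<close>; the other indices contribute
          nothing.\<close>
        have "sum ?h {1..n} = sum ?h {1..n * p ^ j}"
        proof (rule sum.mono_neutral_left)
          have "n * 1 \<le> n * p ^ j" using q by (intro mult_le_mono) auto
          thus "{1..n} \<subseteq> {1..n * p ^ j}" by auto
        qed (auto simp: zero_pow)
        also have "\<dots> = sum ?h ((\<lambda>k. k * p ^ j) ` {1..n})"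
        proof (rule sum.mono_neutral_right)
          show "(\<lambda>k. k * p ^ j) ` {1..n} \<subseteq> {1..n * p ^ j}" using q by (auto simp: Suc_le_eq)
          show "\<forall>i\<in>{1..n * p ^ j} - (\<lambda>k. k * p ^ j) ` {1..n}. ?h i = 0"
          proof
            fix i assume i: "i \<in> {1..n * p ^ j} - (\<lambda>k. k * p ^ j) ` {1..n}"
            have "\<not> p ^ j dvd i"
            proof
              assume "p ^ j dvd i"
              then obtain k where k: "i = k * p ^ j" by (metis dvd_def mult.commute)
              have "1 \<le> k * p ^ j" "k * p ^ j \<le> n * p ^ j" using i unfolding k by auto
              with q have "k \<in> {1..n}" by (simp add: Suc_le_eq)
              with i k show False by blast
            qed
            thus "?h i = 0" by (simp add: \<Phi>_nth)
          qed
        qed simp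
        also have "\<dots> = (\<Sum>k=1..n. ?h (k * p ^ j))"
          using q by (subst sum.reindex) (auto simp: inj_on_def)
        finally show ?thesis using prime_pos by (simp add: \<Phi>_nth)
      qed
      have rhs: "fps_nth (\<Phi> j L) n
          = (\<Sum>k=1..n. (\<phi> ^^ j) (fps_nth f k) * fps_nth (\<Phi> j (F ^ k)) n)" for j
      proof (cases "p ^ j dvd n")
        case True
        have "fps_nth (\<Phi> j L) n = (\<phi> ^^ j) (fps_nth L (n div p ^ j))"
          by (simp add: \<Phi>_nth True)
        also have "\<dots> = (\<Sum>k=1..n. (\<phi> ^^ j) (fps_nth f k) * (\<phi> ^^ j) (fps_nth (F ^ k) (n div p ^ j)))"
          by (subst compose) (simp_all only: endo_funpow_simps div_le_dividend)
        finally show ?thesis by (simp add: \<Phi>_nth True)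
      qed (simp add: \<Phi>_nth)
      define e where "e j k = s j * ((\<phi> ^^ j) (fps_nth f k)
          * (fps_nth (F ^ (k * p ^ j)) n - fps_nth (\<Phi> j (F ^ k)) n))" for j k
      have eA: "e j k \<in> A" if "j \<ge> 1" "k \<ge> 1" for j k
      proof -
        let ?v = "multiplicity p k"
        have "k * p ^ j \<ge> 1 * 2"
          using that less_prime_power[of j] by (intro mult_le_mono) auto
        hence 1: "fps_nth (F ^ (k * p ^ j)) n = fps_nth (F' ^ (k * p ^ j)) n"
          by (intro pow_top) simp
        have 2: "fps_nth (\<Phi> j (F ^ k)) n = fps_nth (\<Phi> j (F' ^ k)) n"
        proof -
          have "1 < p ^ j" using that less_prime_power[of j] by linarith
          hence "n div p ^ j < n" using False by (intro div_less_dividend) auto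
          thus ?thesis by (simp add: \<Phi>_nth pow_low)
        qed
        \<comment> \<open>Of the \<open>?v + 1\<close> factors \<open>p\<close> gained here, one
          clears the denominator of \<open>s j\<close> and the others that of the coefficient of
          \<open>f\<close> at \<open>k\<close>.\<close>
        have "T.pcong (Suc ?v) (F' ^ (k * p ^ j)) (\<Phi> j (F' ^ k))"
          unfolding \<Phi>_def by (rule T.pcong_frob_power[OF F'A]) (rule multiplicity_dvd)
        then obtain C where C: "C \<in> fps_over A"
          "F' ^ (k * p ^ j) - \<Phi> j (F' ^ k) = of_nat (p ^ Suc ?v) * C"
          unfolding T.pcong_def by blast
        have "fps_nth (F ^ (k * p ^ j)) n - fps_nth (\<Phi> j (F ^ k)) n
            = fps_nth (F' ^ (k * p ^ j) - \<Phi> j (F' ^ k)) n"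
          unfolding 1 2 by simp
        also have "\<dots> = of_nat (p ^ Suc ?v) * fps_nth C n"
          unfolding C(2) by (simp flip: fps_of_nat del: of_nat_power)
        finally have "e j k = (of_nat p * s j) *
            ((\<phi> ^^ j) (of_nat (p ^ ?v) * fps_nth f k) * fps_nth C n)"
          by (simp add: e_def endo_funpow_simps(4,7,8) mult_ac)
        also have "\<dots> \<in> A"
          using that C(1) by (intro mult_closed s funpow_closed f_den) (auto simp: fps_over_def)
        finally show ?thesis .
      qed
      have "fps_nth L n - (\<Sum>j=1..n. s j * fps_nth (\<Phi> j L) n)
          = (\<Sum>k=1..n. fps_nth f k * fps_nth (F ^ k) n)
            - (\<Sum>j=1..n. s j * (\<Sum>k=1..n. (\<phi> ^^ j) (fps_nth f k) * fps_nth (\<Phi> j (F ^ k)) n))"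
        by (simp add: rhs compose)
      also have "(\<Sum>k=1..n. fps_nth f k * fps_nth (F ^ k) n)
          = (\<Sum>k=1..n. g k * fps_nth (F ^ k) n)
            + (\<Sum>k=1..n. \<Sum>j=1..n. s j * fps_nth (\<Phi> j f) k * fps_nth (F ^ k) n)"
        by (simp add: g_def left_diff_distrib sum_distrib_right flip: sum.distrib)
      also have "(\<Sum>k=1..n. \<Sum>j=1..n. s j * fps_nth (\<Phi> j f) k * fps_nth (F ^ k) n)
          = (\<Sum>j=1..n. s j * (\<Sum>k=1..n. fps_nth (\<Phi> j f) k * fps_nth (F ^ k) n))"
        by (subst sum.swap) (simp add: sum_distrib_left mult.assoc)
      also have "\<dots> = (\<Sum>j=1..n. s j * (\<Sum>k=1..n. (\<phi> ^^ j) (fps_nth f k) * fps_nth (F ^ (k * p ^ j)) n))"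
        by (simp only: lhs)
      also have "(\<Sum>k=1..n. g k * fps_nth (F ^ k) n) + \<dots>
          - (\<Sum>j=1..n. s j * (\<Sum>k=1..n. (\<phi> ^^ j) (fps_nth f k) * fps_nth (\<Phi> j (F ^ k)) n))
          = (\<Sum>k=1..n. g k * fps_nth (F ^ k) n) + (\<Sum>j=1..n. \<Sum>k=1..n. e j k)"
        by (simp add: e_def sum_distrib_left right_diff_distrib sum_subtractf)
      \<comment> \<open>The unknown coefficient occurs only for \<open>k = 1\<close>, and with
        factor \<open>g 1 = 1\<close>.\<close>
      also have "(\<Sum>k=1..n. g k * fps_nth (F ^ k) n)
          = fps_nth F n + (\<Sum>k=2..n. g k * fps_nth (F' ^ k) n)"
      proof -
        have "{1..n} = insert 1 {2..n}" using False by auto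
        thus ?thesis by (simp add: g1 pow_top del: One_nat_def)
      qed
      finally have "fps_nth F n = (fps_nth L n - (\<Sum>j=1..n. s j * fps_nth (\<Phi> j L) n))
          - (\<Sum>k=2..n. g k * fps_nth (F' ^ k) n) - (\<Sum>j=1..n. \<Sum>k=1..n. e j k)"
        by (simp add: algebra_simps)
      moreover have "fps_nth L n - (\<Sum>j=1..n. s j * fps_nth (\<Phi> j L) n) \<in> A"
        using L False by (simp add: hazewinkel_def \<Phi>_def)
      ultimately show ?thesis
        by (auto intro!: diff_closed sum_closed eA mult_closed gA F'kA)
    qed
  qed
  thus ?thesis by (simp add: fps_over_def)
qed

end

section \<open>Dwork expansions and Frobenius lifts on Laurent polynomials\<close>

text \<open>The expansion of \<open>V ^ (p ^ s - 1)\<close> solved for its last summand, in which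
  \<open>D\<^sub>s\<close> is multiplied by the image of \<open>V ^ 0\<close>, that is, by
  1.\<close>

fun dwork_coeff :: "nat \<Rightarrow> ('a \<Rightarrow> 'a) \<Rightarrow> 'a::comm_ring_1 \<Rightarrow> nat \<Rightarrow> 'a" where
  "dwork_coeff p \<phi> V s = V ^ (p ^ s - 1)
     - (\<Sum>j\<in>{1..<s}. dwork_coeff p \<phi> V j * (\<phi> ^^ j) (V ^ (p ^ (s - j) - 1)))"

declare dwork_coeff.simps [simp del]

context frobenius_subring
begin

lemma dwork_expansion:
  assumes "s \<ge> 1"
  shows "V ^ (p ^ s - 1) = (\<Sum>j=1..s. dwork_coeff p \<phi> V j * (\<phi> ^^ j) (V ^ (p ^ (s - j) - 1)))"
proof -
  have "{1..s} = insert s {1..<s}" using assms by auto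
  thus ?thesis by (simp add: dwork_coeff.simps[of p \<phi> V s] endo_funpow_simps(2))
qed

text \<open>Multiply the expansion of \<open>V ^ (p ^ s - 1)\<close> by
  \<open>V ^ ((m - 1) * p ^ s)\<close> and replace this factor in the \<open>j\<close>-th term by a
  Frobenius image, correct modulo \<open>p ^ (s - j + 1)\<close>; the factor
  \<open>p ^ (j - 1)\<close> of the coefficient restores \<open>p ^ s\<close>. Divisibility is
  assumed only up to \<open>s\<close>, so that the lemma can serve in the induction proving
  it.\<close>

lemma dwork_expansion_multiple:
  assumes V: "V \<in> A" and "m \<ge> 1"
    and dvd: "\<And>j. 1 \<le> j \<Longrightarrow> j \<le> s \<Longrightarrow> \<exists>e\<in>A. dwork_coeff p \<phi> V j = of_nat (p ^ (j - 1)) * e"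
  shows "pcong s (V ^ (m * p ^ s - 1))
    (\<Sum>j=1..s. dwork_coeff p \<phi> V j * (\<phi> ^^ j) (V ^ (m * p ^ (s - j) - 1)))"
proof (cases "s = 0")
  case True
  thus ?thesis using V by (intro pcongI[of "V ^ (m - 1)"] power_closed) auto
next
  case False
  have split: "m * p ^ i - 1 = (p ^ i - 1) + (m - 1) * p ^ i" for i
  proof -
    have "p ^ i > 0" using prime_pos by simp
    moreover have "m * p ^ i = p ^ i + (m - 1) * p ^ i"
      using assms(2) by (cases m) auto
    ultimately show ?thesis by linarith
  qed
  let ?D = "dwork_coeff p \<phi> V"
  have "V ^ (m * p ^ s - 1) = V ^ (p ^ s - 1) * V ^ ((m - 1) * p ^ s)"
    unfolding split by (rule power_add)
  also have "\<dots> = (\<Sum>j=1..s. ?D j * ((\<phi> ^^ j) (V ^ (p ^ (s - j) - 1)) * V ^ ((m - 1) * p ^ s)))"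
    using False by (subst dwork_expansion) (auto simp: sum_distrib_right mult.assoc)
  finally have 1: "V ^ (m * p ^ s - 1) = \<dots>" .
  have 2: "pcong s (?D j * ((\<phi> ^^ j) (V ^ (p ^ (s - j) - 1)) * V ^ ((m - 1) * p ^ s)))
      (?D j * (\<phi> ^^ j) (V ^ (m * p ^ (s - j) - 1)))" if j: "j \<in> {1..s}" for j
  proof -
    have e: "(m - 1) * p ^ s = ((m - 1) * p ^ (s - j)) * p ^ j"
      using j by (simp flip: power_add)
    have "pcong (Suc (s - j)) (V ^ ((m - 1) * p ^ s)) ((\<phi> ^^ j) (V ^ ((m - 1) * p ^ (s - j))))"
      unfolding e by (rule pcong_frob_power[OF V]) simp
    hence c: "pcong (Suc (s - j))
        ((\<phi> ^^ j) (V ^ (p ^ (s - j) - 1)) * V ^ ((m - 1) * p ^ s))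
        ((\<phi> ^^ j) (V ^ (p ^ (s - j) - 1)) * (\<phi> ^^ j) (V ^ ((m - 1) * p ^ (s - j))))"
      by (intro pcong_mult pcong_refl funpow_closed power_closed V)
    obtain d where "d \<in> A" "?D j = of_nat (p ^ (j - 1)) * d" using dvd[of j] j by auto
    from pcong_mult_dvd[OF c this(2,1)] have "pcong s
        (?D j * ((\<phi> ^^ j) (V ^ (p ^ (s - j) - 1)) * V ^ ((m - 1) * p ^ s)))
        (?D j * ((\<phi> ^^ j) (V ^ (p ^ (s - j) - 1)) * (\<phi> ^^ j) (V ^ ((m - 1) * p ^ (s - j)))))"
      using j by simp
    thus ?thesis by (simp only: split[of "s - j"] power_add endo_funpow_simps)
  qed
  show ?thesis unfolding 1 by (rule pcong_sum) (rule 2)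
qed

text \<open>For \<open>m = p\<close> and \<open>s - 1\<close> in place of \<open>s\<close>, the
  approximating sum is exactly the one subtracted in the definition of
  \<open>dwork_coeff\<close>.\<close>

lemma dwork_coeff_dvd:
  assumes V: "V \<in> A" and "s \<ge> 1"
  shows "\<exists>e\<in>A. dwork_coeff p \<phi> V s = of_nat (p ^ (s - 1)) * e"
  using assms(2)
proof (induction s rule: less_induct)
  case (less s)
  then obtain t where s: "s = Suc t" by (cases s) auto
  have "pcong t (V ^ (p * p ^ t - 1))
      (\<Sum>j=1..t. dwork_coeff p \<phi> V j * (\<phi> ^^ j) (V ^ (p * p ^ (t - j) - 1)))"
    using less.IH prime_pos by (intro dwork_expansion_multiple V) (auto simp: s)
  moreover have "(\<Sum>j=1..t. dwork_coeff p \<phi> V j * (\<phi> ^^ j) (V ^ (p * p ^ (t - j) - 1)))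
      = (\<Sum>j\<in>{1..<s}. dwork_coeff p \<phi> V j * (\<phi> ^^ j) (V ^ (p ^ (s - j) - 1)))"
    by (rule sum.cong) (auto simp: s Suc_diff_le)
  ultimately show ?case
    by (subst dwork_coeff.simps) (simp add: s pcong_def)
qed

lemma dwork_congruence:
  assumes "V \<in> A" and "m \<ge> 1"
  shows "pcong s (V ^ (m * p ^ s - 1))
    (\<Sum>j=1..s. dwork_coeff p \<phi> V j * (\<phi> ^^ j) (V ^ (m * p ^ (s - j) - 1)))"
  using assms dwork_coeff_dvd by (intro dwork_expansion_multiple)

end

section \<open>The Frobenius lift on Laurent polynomials\<close>

lemma poly_mapping_sum_single: "(\<Sum>v\<in>Poly_Mapping.keys W. Poly_Mapping.single v (Poly_Mapping.lookup W v)) = W"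
  by (rule poly_mapping_eqI) (auto simp: lookup_sum lookup_single when_def in_keys_iff)

definition laurent_frob ::
    "nat \<Rightarrow> ('a \<Rightarrow> 'a) \<Rightarrow> ('a::comm_ring_1, 'm::finite) laurent_poly \<Rightarrow> ('a, 'm) laurent_poly" where
  "laurent_frob p \<sigma> W =
     (\<Sum>v\<in>Poly_Mapping.keys W. Poly_Mapping.single (int p *s v) (\<sigma> (Poly_Mapping.lookup W v)))"

text \<open>Cancellation can shrink the support of a sum; a common index set makes additivity a
  termwise statement.\<close>

lemma laurent_frob_superset:
  assumes "\<sigma> 0 = 0" "finite S" "Poly_Mapping.keys W \<subseteq> S"
  shows "laurent_frob p \<sigma> W = (\<Sum>v\<in>S. Poly_Mapping.single (int p *s v) (\<sigma> (Poly_Mapping.lookup W v)))"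
  unfolding laurent_frob_def using assms
  by (intro sum.mono_neutral_left) (auto simp: in_keys_iff)

lemma laurent_frob_single:
  assumes "\<sigma> 0 = 0"
  shows "laurent_frob p \<sigma> (Poly_Mapping.single v c) = Poly_Mapping.single (int p *s v) (\<sigma> c)"
  using laurent_frob_superset[where \<sigma> = \<sigma> and S = "{v}" and W = "Poly_Mapping.single v c", OF assms]
  by simp

lemma laurent_frob_add:
  assumes "ring_endomorphism \<sigma>"
  shows "laurent_frob p \<sigma> (V + W) = laurent_frob p \<sigma> V + laurent_frob p \<sigma> W"
proof -
  let ?S = "Poly_Mapping.keys V \<union> Poly_Mapping.keys W"
  note sup = laurent_frob_superset[where \<sigma> = \<sigma> and S = ?S, OF ring_endomorphism_simps(1)[OF assms]]
  show ?thesis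
    using keys_add[of V W]
    by (subst (1 2 3) sup)
      (simp_all add: lookup_add single_add ring_endomorphism_simps[OF assms] sum.distrib)
qed

lemma ring_endomorphism_laurent_frob:
  assumes \<sigma>: "ring_endomorphism \<sigma>"
  shows "ring_endomorphism (laurent_frob p \<sigma> :: ('a::comm_ring_1, 'm::finite) laurent_poly \<Rightarrow> _)"
  unfolding ring_endomorphism_def
proof (intro conjI allI)
  note s = ring_endomorphism_simps[OF \<sigma>]
  let ?\<Phi> = "laurent_frob p \<sigma> :: ('a, 'm) laurent_poly \<Rightarrow> _"
  have "?\<Phi> (Poly_Mapping.single 0 1) = Poly_Mapping.single (int p *s 0) (\<sigma> 1)"
    by (rule laurent_frob_single) (rule s)
  thus "?\<Phi> 1 = 1" by (simp add: s)
  show add: "?\<Phi> (V + W) = ?\<Phi> V + ?\<Phi> W" for V W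
    by (rule laurent_frob_add[OF \<sigma>])
  have zero: "?\<Phi> 0 = 0" by (simp add: laurent_frob_def)
  have sum: "?\<Phi> (sum h X) = (\<Sum>x\<in>X. ?\<Phi> (h x))" for h :: "int ^ 'm \<Rightarrow> _" and X
    by (induction X rule: infinite_finite_induct) (simp_all add: zero add)
  fix V W :: "('a, 'm) laurent_poly"
  let ?s = "\<lambda>V v. Poly_Mapping.single v (Poly_Mapping.lookup V v)"
  \<comment> \<open>Additivity reduces multiplicativity to products of monomials.\<close>
  have "V * W = (\<Sum>v\<in>Poly_Mapping.keys V. ?s V v) * (\<Sum>w\<in>Poly_Mapping.keys W. ?s W w)"
    by (simp add: poly_mapping_sum_single)
  also have "?\<Phi> \<dots> = ?\<Phi> V * ?\<Phi> W"
    unfolding sum_product sum laurent_frob_def[of _ _ V] laurent_frob_def[of _ _ W]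
    by (simp add: mult_single laurent_frob_single s vector_add_ldistrib)
  finally show "?\<Phi> (V * W) = ?\<Phi> V * ?\<Phi> W" .
qed

text \<open>Iterates have the same shape, so results on \<open>laurent_frob q \<tau>\<close> for
  arbitrary \<open>q\<close> and \<open>\<tau>\<close> cover them.\<close>

lemma funpow_laurent_frob:
  fixes W :: "('a::comm_ring_1, 'm::finite) laurent_poly"
  assumes \<sigma>: "ring_endomorphism \<sigma>"
  shows "(laurent_frob p \<sigma> ^^ j) W = laurent_frob (p ^ j) (\<sigma> ^^ j) W"
proof -
  note s = ring_endomorphism_simps[OF \<sigma>]
  note \<Phi> = ring_endomorphism_funpow[OF ring_endomorphism_laurent_frob[OF \<sigma>]]
  have single: "(laurent_frob p \<sigma> ^^ j) (Poly_Mapping.single v c)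
      = Poly_Mapping.single (int (p ^ j) *s v) ((\<sigma> ^^ j) c)" for v :: "int ^ 'm" and c
    by (induction j) (simp_all add: laurent_frob_single s mult.commute)
  have "(laurent_frob p \<sigma> ^^ j) (\<Sum>v\<in>Poly_Mapping.keys W. Poly_Mapping.single v (Poly_Mapping.lookup W v))
      = laurent_frob (p ^ j) (\<sigma> ^^ j) W"
    unfolding ring_endomorphism_simps(9)[OF \<Phi>] single laurent_frob_def ..
  thus ?thesis by (simp add: poly_mapping_sum_single)
qed

lemma single_power:
  fixes v :: "int ^ 'm::finite"
  shows "Poly_Mapping.single v c ^ n = Poly_Mapping.single (int n *s v) (c ^ n :: 'a::comm_ring_1)"
  by (induction n) (simp_all add: mult_single vector_sadd_rdistrib)

lemma frobenius_subring_laurent: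
  fixes \<sigma> :: "'a::comm_ring_1 \<Rightarrow> 'a"
  assumes p: "prime p" and \<sigma>: "frobenius_lift p \<sigma>"
  shows "frobenius_subring p UNIV (laurent_frob p \<sigma> :: ('a, 'm::finite) laurent_poly \<Rightarrow> _)"
proof
  have endo: "ring_endomorphism \<sigma>" using \<sigma> by (simp add: frobenius_lift_def)
  let ?\<Phi> = "laurent_frob p \<sigma> :: ('a, 'm) laurent_poly \<Rightarrow> _"
  show "ring_endomorphism ?\<Phi>" by (rule ring_endomorphism_laurent_frob[OF endo])
  fix W :: "('a, 'm) laurent_poly"
  have single: "\<exists>C. ?\<Phi> (Poly_Mapping.single v c) - Poly_Mapping.single v c ^ p = of_nat p * C" for v c
  proof -
    obtain d where "\<sigma> c - c ^ p = of_nat p * d"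
      using \<sigma> by (auto simp: frobenius_lift_def dvd_def)
    hence "?\<Phi> (Poly_Mapping.single v c) - Poly_Mapping.single v c ^ p
        = Poly_Mapping.single 0 (of_nat p) * Poly_Mapping.single (int p *s v) d"
      by (simp add: laurent_frob_single ring_endomorphism_simps[OF endo] single_power mult_single
          del: single_of_nat flip: single_diff)
    thus ?thesis by (auto simp: single_of_nat)
  qed
  have "\<exists>C\<in>UNIV. ?\<Phi> (\<Sum>v\<in>S. Poly_Mapping.single v (Poly_Mapping.lookup W v))
      - (\<Sum>v\<in>S. Poly_Mapping.single v (Poly_Mapping.lookup W v)) ^ p = of_nat p * C" if "finite S" for S
    using that
  proof (induction S)
    case empty
    have "?\<Phi> 0 = 0" by (simp add: laurent_frob_def)
    thus ?case using p prime_gt_0_nat[of p] by (auto simp: zero_power intro!: exI[of _ 0])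
  next
    case (insert v S)
    show ?case
      unfolding sum.insert[OF insert.hyps]
      using laurent_frob_add[OF endo] single insert.IH
      by (intro frobenius_congruence_add p) auto
  qed
  from this[of "Poly_Mapping.keys W"] show "\<exists>C\<in>UNIV. ?\<Phi> W - W ^ p = of_nat p * C"
    by (simp add: poly_mapping_sum_single)
qed (use p in auto)

section \<open>Supports and central coefficients\<close>

lemma lookup_times_single:
  fixes Q :: "('a::comm_ring_1, 'm::finite) laurent_poly"
  shows "Poly_Mapping.lookup (Q * Poly_Mapping.single k c) u = Poly_Mapping.lookup Q (u - k) * c"
proof -
  have "Q * Poly_Mapping.single k c
      = (\<Sum>v\<in>Poly_Mapping.keys Q. Poly_Mapping.single v (Poly_Mapping.lookup Q v)) * Poly_Mapping.single k c"
    by (simp add: poly_mapping_sum_single)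
  also have "\<dots> = (\<Sum>v\<in>Poly_Mapping.keys Q. Poly_Mapping.single (v + k) (Poly_Mapping.lookup Q v * c))"
    by (simp add: sum_distrib_right mult_single)
  also have "Poly_Mapping.lookup \<dots> u
      = (\<Sum>v\<in>Poly_Mapping.keys Q. if v = u - k then Poly_Mapping.lookup Q v * c else 0)"
    unfolding lookup_sum lookup_single by (rule sum.cong) (auto simp: when_def)
  also have "\<dots> = Poly_Mapping.lookup Q (u - k) * c"
    by (simp add: in_keys_iff)
  finally show ?thesis .
qed

lemma lookup_times_laurent_frob:
  "Poly_Mapping.lookup (Q * laurent_frob q \<tau> W) u
    = (\<Sum>v\<in>Poly_Mapping.keys W. Poly_Mapping.lookup Q (u - int q *s v) * \<tau> (Poly_Mapping.lookup W v))"
  by (simp add: laurent_frob_def sum_distrib_left lookup_sum lookup_times_single)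

lemma real_vec_add: "real_vec (u + v) = real_vec u + real_vec v"
  by (simp add: real_vec_def vec_eq_iff)

lemma real_vec_scale: "real_vec (int n *s u) = real n *\<^sub>R real_vec u"
  by (simp add: real_vec_def vec_eq_iff)

lemma real_vec_inj: "real_vec u = real_vec v \<longleftrightarrow> u = v"
  by (simp add: real_vec_def vec_eq_iff)

definition supported_in :: "(real ^ 'm) set \<Rightarrow> nat \<Rightarrow> ('a::zero, 'm::finite) laurent_poly \<Rightarrow> bool" where
  "supported_in \<Delta> n Q \<longleftrightarrow> (\<forall>u\<in>Poly_Mapping.keys Q. \<exists>x\<in>\<Delta>. real_vec u = real n *\<^sub>R x)"

lemma supported_in_diff:
  fixes Q Q' :: "('a::ab_group_add, 'm::finite) laurent_poly"
  assumes "supported_in \<Delta> n Q" "supported_in \<Delta> n Q'"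
  shows "supported_in \<Delta> n (Q - Q')"
proof -
  have "Poly_Mapping.keys (Q - Q') \<subseteq> Poly_Mapping.keys Q \<union> Poly_Mapping.keys Q'"
    by (auto simp: in_keys_iff lookup_minus)
  thus ?thesis using assms unfolding supported_in_def by blast
qed

lemma supported_in_sum:
  fixes h :: "'b \<Rightarrow> ('a::ab_group_add, 'm::finite) laurent_poly"
  assumes "\<And>x. x \<in> X \<Longrightarrow> supported_in \<Delta> n (h x)"
  shows "supported_in \<Delta> n (sum h X)"
  unfolding supported_in_def
proof
  fix u assume "u \<in> Poly_Mapping.keys (sum h X)"
  hence "(\<Sum>x\<in>X. Poly_Mapping.lookup (h x) u) \<noteq> 0" by (simp add: in_keys_iff lookup_sum)
  then obtain x where "x \<in> X" "Poly_Mapping.lookup (h x) u \<noteq> 0" 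
    by (rule sum.not_neutral_contains_not_neutral)
  thus "\<exists>x\<in>\<Delta>. real_vec u = real n *\<^sub>R x"
    using assms by (auto simp: supported_in_def in_keys_iff)
qed

text \<open>By convexity, the Minkowski sum of two dilates of \<open>\<Delta>\<close> lies in the
  dilate by the sum of the factors; the weights are \<open>n\<close> and \<open>n'\<close> divided
  by \<open>n + n'\<close>.\<close>

lemma supported_in_mult:
  fixes Q Q' :: "('a::comm_ring_1, 'm::finite) laurent_poly"
  assumes "convex \<Delta>" "supported_in \<Delta> n Q" "supported_in \<Delta> n' Q'"
  shows "supported_in \<Delta> (n + n') (Q * Q')"
  unfolding supported_in_def
proof
  fix u assume "u \<in> Poly_Mapping.keys (Q * Q')"
  then obtain a b where u: "u = a + b" "a \<in> Poly_Mapping.keys Q" "b \<in> Poly_Mapping.keys Q'"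
    using keys_mult[of Q Q'] by blast
  then obtain x y where xy: "x \<in> \<Delta>" "y \<in> \<Delta>" "real_vec a = real n *\<^sub>R x" "real_vec b = real n' *\<^sub>R y"
    using assms(2,3) unfolding supported_in_def by blast
  show "\<exists>x\<in>\<Delta>. real_vec u = real (n + n') *\<^sub>R x"
  proof (cases "n + n' = 0")
    case True
    thus ?thesis using xy u by (auto simp: real_vec_add)
  next
    case False
    let ?z = "(real n / real (n + n')) *\<^sub>R x + (real n' / real (n + n')) *\<^sub>R y"
    have "?z \<in> \<Delta>"
      using xy False by (intro convexD[OF assms(1)]) (auto simp flip: add_divide_distrib)
    moreover have "real_vec u = real (n + n') *\<^sub>R ?z"
      unfolding u(1) real_vec_add xy scaleR_add_right scaleR_scaleR
      using False by (simp add: add_nonneg_eq_0_iff)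
    ultimately show ?thesis by blast
  qed
qed

lemma supported_in_power:
  fixes V :: "('a::comm_ring_1, 'm::finite) laurent_poly"
  assumes "convex \<Delta>" "\<Delta> \<noteq> {}" "supported_in \<Delta> 1 V"
  shows "supported_in \<Delta> n (V ^ n)"
proof (induction n)
  case 0
  have "real_vec 0 = (0 :: real ^ 'm)" by (simp add: real_vec_def vec_eq_iff)
  thus ?case using assms(2) by (auto simp: supported_in_def)
next
  case (Suc n)
  show ?case using supported_in_mult[OF assms(1,3) Suc] by simp
qed

lemma supported_in_laurent_frob:
  assumes "supported_in \<Delta> n W"
  shows "supported_in \<Delta> (q * n) (laurent_frob q \<tau> W)"
  unfolding laurent_frob_def
proof (rule supported_in_sum)
  fix v assume "v \<in> Poly_Mapping.keys W"
  then obtain x where "x \<in> \<Delta>" "real_vec v = real n *\<^sub>R x"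
    using assms unfolding supported_in_def by blast
  thus "supported_in \<Delta> (q * n) (Poly_Mapping.single (int q *s v) (\<tau> (Poly_Mapping.lookup W v)))"
    by (auto simp: supported_in_def real_vec_scale)
qed

text \<open>The dilation factors in the recursion match:
  \<open>(p ^ j - 1) + p ^ j * (p ^ (s - j) - 1) = p ^ s - 1\<close>.\<close>

lemma supported_in_dwork_coeff:
  fixes V :: "('a::comm_ring_1, 'm::finite) laurent_poly"
  assumes \<Delta>: "convex \<Delta>" "\<Delta> \<noteq> {}" "supported_in \<Delta> 1 V"
    and \<sigma>: "ring_endomorphism \<sigma>" and p: "p > 0"
  shows "supported_in \<Delta> (p ^ s - 1) (dwork_coeff p (laurent_frob p \<sigma>) V s)"
proof (induction s rule: less_induct)
  case (less s)
  let ?D = "dwork_coeff p (laurent_frob p \<sigma>) V"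
  have "supported_in \<Delta> (p ^ s - 1) (?D j * (laurent_frob p \<sigma> ^^ j) (V ^ (p ^ (s - j) - 1)))"
    if j: "j \<in> {1..<s}" for j
  proof -
    have "supported_in \<Delta> ((p ^ j - 1) + p ^ j * (p ^ (s - j) - 1))
        (?D j * laurent_frob (p ^ j) (\<sigma> ^^ j) (V ^ (p ^ (s - j) - 1)))"
      using less[of j] j by (intro supported_in_mult \<Delta> supported_in_laurent_frob supported_in_power) auto
    moreover have "(p ^ j - 1) + p ^ j * (p ^ (s - j) - 1) = p ^ s - 1"
    proof -
      have "p ^ j * p ^ (s - j) = p ^ s" using j by (simp flip: power_add)
      hence "p ^ j * (p ^ (s - j) - 1) = p ^ s - p ^ j" by (simp add: diff_mult_distrib2)
      moreover have "p ^ j > 0" "p ^ j \<le> p ^ s"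
        using p j by (auto intro: power_increasing)
      ultimately show ?thesis by linarith
    qed
    ultimately show ?thesis by (simp add: funpow_laurent_frob[OF \<sigma>])
  qed
  thus ?case
    by (subst dwork_coeff.simps) (intro supported_in_diff supported_in_sum supported_in_power \<Delta>)
qed

text \<open>
  If \<open>u + w = q t\<close> with \<open>u\<close> in \<open>(q - 1) \<Delta>\<close>, then \<open>t\<close> is a convex combination with positive weight
  at the interior point \<open>w\<close>, hence an interior lattice point, i.e. \<open>t = w\<close>.
\<close>

lemma lookup_central_times_laurent_frob:
  fixes Q W :: "('a::comm_ring_1, 'm::finite) laurent_poly"
  assumes \<Delta>: "convex \<Delta>" and w: "{real_vec w} = rel_interior \<Delta> \<inter> range real_vec"
    and Q: "supported_in \<Delta> (q - 1) Q" and "q > 0" "M > 0" and \<tau>: "\<tau> 0 = 0"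
  shows "Poly_Mapping.lookup (Q * laurent_frob q \<tau> W) (int (M * q - 1) *s w)
    = Poly_Mapping.lookup Q (int (q - 1) *s w) * \<tau> (Poly_Mapping.lookup W (int (M - 1) *s w))"
proof -
  let ?u = "\<lambda>v. int (M * q - 1) *s w - int q *s v"
  have q: "int (M * q - 1) = int M * int q - 1"
    using assms(4,5) by (simp add: of_nat_diff)
  have key: "v = int (M - 1) *s w" if "?u v \<in> Poly_Mapping.keys Q" for v
  proof -
    obtain x where x: "x \<in> \<Delta>" "real_vec (?u v) = real (q - 1) *\<^sub>R x"
      using Q \<open>?u v \<in> _\<close> unfolding supported_in_def by blast
    let ?t = "int M *s w - v"
    have "?u v + w = int q *s ?t"
      unfolding q by (simp add: vec_eq_iff algebra_simps)
    hence "real q *\<^sub>R real_vec ?t = real (q - 1) *\<^sub>R x + real_vec w"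
      using x(2) by (metis real_vec_add real_vec_scale)
    \<comment> \<open>Rewritten as a shrinking of \<open>x\<close> towards \<open>w\<close> by the
      positive ratio \<open>1 / q\<close>, which leads into the relative interior.\<close>
    also have "\<dots> = real q *\<^sub>R (x - (1 / real q) *\<^sub>R (x - real_vec w))"
      using assms(4) by (simp add: algebra_simps of_nat_diff)
    finally have "real_vec ?t = x - (1 / real q) *\<^sub>R (x - real_vec w)"
      using assms(4) by simp
    moreover have "x - (1 / real q) *\<^sub>R (x - real_vec w) \<in> rel_interior \<Delta>"
      using w x(1) assms(4) by (intro rel_interior_convex_shrink \<Delta>) auto
    ultimately have "real_vec ?t \<in> rel_interior \<Delta> \<inter> range real_vec" by (metis IntI rangeI)
    hence "?t = w" unfolding w[symmetric] by (simp add: real_vec_inj)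
    thus ?thesis using assms(5) by (simp add: vec_eq_iff algebra_simps of_nat_diff)
  qed
  have u0: "?u (int (M - 1) *s w) = int (q - 1) *s w"
    unfolding q using assms(4,5) by (simp add: vec_eq_iff algebra_simps of_nat_diff)
  have "Poly_Mapping.lookup (Q * laurent_frob q \<tau> W) (int (M * q - 1) *s w)
      = (\<Sum>v\<in>Poly_Mapping.keys W. Poly_Mapping.lookup Q (?u v) * \<tau> (Poly_Mapping.lookup W v))"
    by (rule lookup_times_laurent_frob)
  also have "\<dots> = (\<Sum>v\<in>Poly_Mapping.keys W. if v = int (M - 1) *s w
      then Poly_Mapping.lookup Q (int (q - 1) *s w) * \<tau> (Poly_Mapping.lookup W v) else 0)"
  proof (rule sum.cong)
    fix v
    show "Poly_Mapping.lookup Q (?u v) * \<tau> (Poly_Mapping.lookup W v) = (if v = int (M - 1) *s w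
        then Poly_Mapping.lookup Q (int (q - 1) *s w) * \<tau> (Poly_Mapping.lookup W v) else 0)"
    proof (cases "v = int (M - 1) *s w")
      case False
      hence "?u v \<notin> Poly_Mapping.keys Q" using key by blast
      thus ?thesis using False by (simp add: in_keys_iff)
    next
      case True
      thus ?thesis by (simp only: u0 if_True simp_thms)
    qed
  qed simp
  \<comment> \<open>If \<open>(M - 1) w\<close> is not an exponent of \<open>W\<close>, both sides
    vanish because \<open>\<tau> 0 = 0\<close>.\<close>
  also have "\<dots> = Poly_Mapping.lookup Q (int (q - 1) *s w) * \<tau> (Poly_Mapping.lookup W (int (M - 1) *s w))"
    using \<tau> by (simp add: in_keys_iff)
  finally show ?thesis .
qed

text \<open>Coefficient comparison in \<open>dwork_congruence\<close>; each summand splits by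
  \<open>lookup_central_times_laurent_frob\<close> with \<open>q = p ^ j\<close> and
  \<open>M = m * p ^ (s - j)\<close>. The \<open>c j\<close> must not depend on \<open>m\<close> and
  \<open>s\<close>, since they become the coefficients of the functional equation.\<close>

theorem central_coeff_congruence:
  fixes V :: "('a::comm_ring_1, 'm::finite) laurent_poly"
  assumes w: "{real_vec w} = rel_interior (newton_polytope V) \<inter> range real_vec"
    and p: "prime p" and \<sigma>: "frobenius_lift p \<sigma>"
  shows "\<exists>c. \<forall>m\<ge>1. \<forall>s. \<exists>d. central_coeff V w (m * p ^ s - 1)
    - (\<Sum>j=1..s. of_nat (p ^ (j - 1)) * c j * (\<sigma> ^^ j) (central_coeff V w (m * p ^ (s - j) - 1)))
    = of_nat (p ^ s) * d"
proof -
  let ?\<Delta> = "newton_polytope V"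
  let ?\<Phi> = "laurent_frob p \<sigma> :: ('a, 'm) laurent_poly \<Rightarrow> _"
  let ?D = "dwork_coeff p ?\<Phi> V"
  interpret frobenius_subring p UNIV ?\<Phi>
    by (rule frobenius_subring_laurent[OF p \<sigma>])
  have endo: "ring_endomorphism \<sigma>" using \<sigma> by (simp add: frobenius_lift_def)
  note \<sigma>0 = ring_endomorphism_simps(1)[OF ring_endomorphism_funpow[OF endo]]
  have \<Delta>: "convex ?\<Delta>" "?\<Delta> \<noteq> {}" "supported_in ?\<Delta> 1 V"
  proof -
    show "convex ?\<Delta>" by (simp add: newton_polytope_def)
    show "?\<Delta> \<noteq> {}" using w rel_interior_subset[of ?\<Delta>] by blast
    show "supported_in ?\<Delta> 1 V"
      by (auto simp: supported_in_def newton_polytope_def intro: hull_inc)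
  qed
  have p0: "p > 0" using p prime_gt_0_nat by blast
  obtain E where E: "\<And>j. j \<ge> 1 \<Longrightarrow> ?D j = of_nat (p ^ (j - 1)) * E j"
    using dwork_coeff_dvd[of V] by (metis UNIV_I)
  have lookup_nat: "Poly_Mapping.lookup (of_nat n * Q) u = of_nat n * Poly_Mapping.lookup Q u"
    for n and Q :: "('a, 'm) laurent_poly" and u
    by (induction n) (simp_all add: algebra_simps lookup_add)
  define c where "c j = Poly_Mapping.lookup (E j) (int (p ^ j - 1) *s w)" for j
  show ?thesis
  proof (intro exI[of _ c] allI impI)
    fix m s :: nat assume m: "m \<ge> 1"
    obtain C where C: "V ^ (m * p ^ s - 1)
        - (\<Sum>j=1..s. ?D j * (?\<Phi> ^^ j) (V ^ (m * p ^ (s - j) - 1))) = of_nat (p ^ s) * C"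
      using dwork_congruence[of V m s] m unfolding pcong_def by auto
    let ?u = "int (m * p ^ s - 1) *s w"
    have "Poly_Mapping.lookup (?D j * (?\<Phi> ^^ j) (V ^ (m * p ^ (s - j) - 1))) ?u
        = of_nat (p ^ (j - 1)) * c j * (\<sigma> ^^ j) (central_coeff V w (m * p ^ (s - j) - 1))"
      if j: "j \<in> {1..s}" for j
    proof -
      have e: "m * p ^ s = (m * p ^ (s - j)) * p ^ j" using j by (simp flip: power_add)
      have "Poly_Mapping.lookup (?D j * (?\<Phi> ^^ j) (V ^ (m * p ^ (s - j) - 1))) ?u
          = Poly_Mapping.lookup (?D j) (int (p ^ j - 1) *s w)
            * (\<sigma> ^^ j) (Poly_Mapping.lookup (V ^ (m * p ^ (s - j) - 1)) (int (m * p ^ (s - j) - 1) *s w))"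
        unfolding funpow_laurent_frob[OF endo] e
        using m p0 by (intro lookup_central_times_laurent_frob[OF \<Delta>(1) w]
            supported_in_dwork_coeff \<Delta> endo \<sigma>0) auto
      thus ?thesis using j by (simp add: E lookup_nat c_def central_coeff_def del: of_nat_power)
    qed
    hence "central_coeff V w (m * p ^ s - 1)
        - (\<Sum>j=1..s. of_nat (p ^ (j - 1)) * c j * (\<sigma> ^^ j) (central_coeff V w (m * p ^ (s - j) - 1)))
        = Poly_Mapping.lookup (of_nat (p ^ s) * C) ?u"
      unfolding C[symmetric] by (simp add: lookup_minus lookup_sum central_coeff_def)
    thus "\<exists>d. central_coeff V w (m * p ^ s - 1)
        - (\<Sum>j=1..s. of_nat (p ^ (j - 1)) * c j * (\<sigma> ^^ j) (central_coeff V w (m * p ^ (s - j) - 1)))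
        = of_nat (p ^ s) * d"
      unfolding lookup_nat by blast
  qed
qed

section \<open>The Frobenius lift on \<open>R \<otimes> \<int>\<^sub>(\<^sub>p\<^sub>)\<close>\<close>

lemma tfrac_0 [simp]: "n > 0 \<Longrightarrow> tfrac 0 n = 0"
  by (auto simp: zero_tensor_rat_tfrac intro!: tfrac_eqI)

lemma tfrac_cancel: "n > 0 \<Longrightarrow> k > 0 \<Longrightarrow> tfrac (of_nat k * r) (k * n) = tfrac r n"
  by (rule tfrac_eqI) (simp_all add: mult_ac)

lemma tfrac_add_same: "n > 0 \<Longrightarrow> tfrac r n + tfrac s n = tfrac (r + s) n"
  by (simp add: add_tfrac) (rule tfrac_eqI, simp_all add: algebra_simps)

lemma tfrac_diff_same: "n > 0 \<Longrightarrow> tfrac r n - tfrac s n = tfrac (r - s) n"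
  by (simp add: minus_tensor_rat_def uminus_tfrac tfrac_add_same)

lemma tfrac_sum_same: "n > 0 \<Longrightarrow> (\<Sum>x\<in>X. tfrac (h x) n) = tfrac (\<Sum>x\<in>X. h x) n"
  by (induction X rule: infinite_finite_induct) (simp_all add: tfrac_add_same)

lemma of_nat_tfrac:
  "(of_nat k :: 'a::{comm_ring_1, ring_char_0} tensor_rat) = tfrac (of_nat k) 1"
  by (induction k) (simp_all add: one_tensor_rat_tfrac tfrac_add_same)

lemma of_nat_times_tfrac:
  fixes r :: "'a::{comm_ring_1, ring_char_0}"
  assumes "n > 0"
  shows "of_nat k * tfrac r n = tfrac (of_nat k * r) n"
  using assms by (simp add: of_nat_tfrac mult_tfrac)

text \<open>Sums of pure tensors can be brought to one denominator, which stays prime to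
  \<open>p\<close> because \<open>p\<close> is prime.\<close>

lemma tensor_Z_loc_tfrac:
  assumes p: "prime p"
  shows "tensor_Z_loc p = {tfrac r d | r d. \<not> p dvd d}" (is "_ = ?A")
proof
  show "?A \<subseteq> tensor_Z_loc p"
  proof
    fix x assume "x \<in> ?A"
    then obtain r d where x: "x = tfrac r d" "\<not> p dvd d" by blast
    hence "d > 0" by (metis dvd_0_right neq0_conv)
    hence "x = (\<Sum>i<Suc 0. tensor r (1 / of_nat d))" by (simp add: x tfrac_conv_tensor)
    moreover have "1 / of_nat d \<in> Z_loc p"
      unfolding Z_loc_def using x(2) by (metis (mono_tags, lifting) mem_Collect_eq of_int_1)
    ultimately show "x \<in> tensor_Z_loc p"
      unfolding tensor_Z_loc_def mem_Collect_eq
      by (intro exI[of _ "Suc 0"] exI[of _ "\<lambda>_. r"] exI[of _ "\<lambda>_. 1 / of_nat d"]) auto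
  qed
  have pos: "d > 0" if "\<not> p dvd d" for d using that by (metis dvd_0_right neq0_conv)
  have add: "x + y \<in> ?A" if xy: "x \<in> ?A" "y \<in> ?A" for x y
  proof -
    obtain r d s e where "x = tfrac r d" "y = tfrac s e" "\<not> p dvd d" "\<not> p dvd e"
      using xy by blast
    moreover from this have "\<not> p dvd d * e" using p by (simp add: prime_dvd_mult_iff)
    ultimately show ?thesis using add_tfrac pos by blast
  qed
  have "\<not> p dvd 1" using prime_gt_1_nat[OF p] by simp
  hence zero: "0 \<in> ?A"
    unfolding zero_tensor_rat_tfrac by blast
  have gen: "tensor r q \<in> ?A" if q: "q \<in> Z_loc p" for r q
  proof -
    obtain a d where q': "q = of_int a / of_nat d" and d: "\<not> p dvd d"
      using q unfolding Z_loc_def by blast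
    have "tensor r q = tfrac (of_int a * r) d"
      unfolding q' by (rule tensor_tfrac[OF pos[OF d]])
    with d show ?thesis by blast
  qed
  show "tensor_Z_loc p \<subseteq> ?A"
  proof
    fix x :: "'a tensor_rat" assume "x \<in> tensor_Z_loc p"
    then obtain k :: nat and r q where x: "x = (\<Sum>i<k. tensor (r i) (q i))" "\<forall>i<k. q i \<in> Z_loc p"
      unfolding tensor_Z_loc_def by blast
    have "(\<Sum>i<l. tensor (r i) (q i)) \<in> ?A" if "l \<le> k" for l
      using that
    proof (induction l)
      case 0
      show ?case using zero by (simp only: lessThan_0 sum.empty)
    next
      case (Suc l)
      thus ?case using x(2) by (simp only: sum.lessThan_Suc) (intro add gen, auto)
    qed
    thus "x \<in> ?A" unfolding x(1) by blast
  qed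
qed

text \<open>The universal property yields \<open>\<sigma> \<otimes> id\<close> as an additive map;
  multiplicativity is checked on fractions.\<close>

lemma tensor_rat_endomorphism:
  fixes \<sigma> :: "'a::{comm_ring_1, ring_char_0} \<Rightarrow> 'a"
  assumes "ring_endomorphism \<sigma>"
  obtains \<sigma>' where "ring_endomorphism \<sigma>'" "\<And>r n. n > 0 \<Longrightarrow> \<sigma>' (tfrac r n) = tfrac (\<sigma> r) n"
proof -
  note s = ring_endomorphism_simps[OF assms]
  have "\<exists>!h :: 'a tensor_rat \<Rightarrow> 'a tensor_rat.
      (\<forall>x y. h (x + y) = h x + h y) \<and> (\<forall>r q. h (tensor r q) = tensor (\<sigma> r) q)"
    by (rule tensor_universal) (simp_all add: s tensor_add_left tensor_add_right)
  then obtain h :: "'a tensor_rat \<Rightarrow> 'a tensor_rat"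
    where add: "\<And>x y. h (x + y) = h x + h y" and h: "\<And>r q. h (tensor r q) = tensor (\<sigma> r) q"
    by blast
  have tfrac: "h (tfrac r n) = tfrac (\<sigma> r) n" if "n > 0" for r n
    using that by (simp add: tfrac_conv_tensor h)
  have "h (x * y) = h x * h y" for x y
  proof -
    obtain a n where "x = tfrac a n" "n > 0" by (rule tfrac_cases)
    moreover obtain b m where "y = tfrac b m" "m > 0" by (rule tfrac_cases)
    ultimately show ?thesis by (simp add: mult_tfrac tfrac s)
  qed
  moreover have "h 1 = 1" by (simp add: one_tensor_rat_tfrac tfrac s)
  ultimately have "ring_endomorphism h" by (simp add: ring_endomorphism_def add)
  thus thesis using tfrac that by blast
qed

text \<open>Fermat's little theorem, from additivity of the Frobenius congruence with the identity
  as lift. It handles denominators below.\<close>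

lemma of_nat_fermat:
  assumes p: "prime p"
  shows "\<exists>e. (of_nat d :: 'a::comm_ring_1) - of_nat d ^ p = of_nat p * e"
proof (induction d)
  case 0
  show ?case using prime_gt_0_nat[OF p] by (auto simp: zero_power intro!: exI[of _ 0])
next
  case (Suc d)
  have "\<exists>e\<in>UNIV. id (1 :: 'a) - 1 ^ p = of_nat p * e"
    by (auto intro!: exI[of _ 0])
  with Suc have "\<exists>e\<in>UNIV. id (1 + of_nat d :: 'a) - (1 + of_nat d) ^ p = of_nat p * e"
    by (intro frobenius_congruence_add p) auto
  thus ?case by simp
qed

lemma frobenius_subring_tensor_Z_loc:
  fixes \<sigma> :: "'a::{comm_ring_1, ring_char_0} \<Rightarrow> 'a"
  assumes p: "prime p" and \<sigma>: "frobenius_lift p \<sigma>"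
    and endo: "ring_endomorphism \<sigma>'" and \<sigma>': "\<And>r n. n > 0 \<Longrightarrow> \<sigma>' (tfrac r n) = tfrac (\<sigma> r) n"
  shows "frobenius_subring p (tensor_Z_loc p) \<sigma>'"
proof
  note A = tensor_Z_loc_tfrac[OF p, where 'a = 'a]
  have pos: "d > 0" if "\<not> p dvd d" for d using that by (metis dvd_0_right neq0_conv)
  have np: "\<not> p dvd 1" using prime_gt_1_nat[OF p] by auto
  show "(1 :: 'a tensor_rat) \<in> tensor_Z_loc p"
    unfolding A one_tensor_rat_tfrac using np by blast
  fix x y :: "'a tensor_rat"
  assume x: "x \<in> tensor_Z_loc p"
  then obtain r d where rd: "x = tfrac r d" "\<not> p dvd d" unfolding A by blast
  show "\<sigma>' x \<in> tensor_Z_loc p"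
    unfolding A using rd \<sigma>'[OF pos] by blast
  {
    assume y: "y \<in> tensor_Z_loc p"
    then obtain s e where se: "y = tfrac s e" "\<not> p dvd e" unfolding A by blast
    have de: "\<not> p dvd d * e" using rd se p by (simp add: prime_dvd_mult_iff)
    have "x - y = tfrac (of_nat e * r + of_nat d * (- s)) (d * e)"
      using rd se pos by (simp add: minus_tensor_rat_def uminus_tfrac add_tfrac del: mult_minus_right)
    thus "x - y \<in> tensor_Z_loc p" unfolding A using de by blast
    have "x * y = tfrac (r * s) (d * e)"
      using rd se pos by (simp add: mult_tfrac)
    thus "x * y \<in> tensor_Z_loc p" unfolding A using de by blast
  }
  show "\<exists>c\<in>tensor_Z_loc p. \<sigma>' x - x ^ p = of_nat p * c"
  proof -
    obtain z where z: "\<sigma> r - r ^ p = of_nat p * z"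
      using \<sigma> by (auto simp: frobenius_lift_def dvd_def)
    have pow: "tfrac r d ^ n = tfrac (r ^ n) (d ^ n)" for n
      using pos[OF rd(2)] by (induction n) (simp_all add: one_tensor_rat_tfrac mult_tfrac)
    obtain e where "(of_nat d :: 'a) - of_nat d ^ p = of_nat p * e"
      using of_nat_fermat[OF p, where 'a = 'a] by blast
    hence e: "(of_nat (d ^ p) :: 'a) = of_nat d - of_nat p * e"
      by (simp add: algebra_simps)
    have dp: "\<not> p dvd d ^ p" using p rd(2) prime_dvd_power by blast
    hence dp': "\<not> p dvd d * d ^ p" using p rd(2) by (simp add: prime_dvd_mult_iff)
    have "\<sigma>' x - x ^ p = tfrac (of_nat (d ^ p) * \<sigma> r + of_nat d * (- (r ^ p))) (d * d ^ p)"
      unfolding rd(1) pow using pos[OF dp] pos[OF rd(2)]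
      by (simp add: \<sigma>' minus_tensor_rat_def uminus_tfrac add_tfrac del: of_nat_power mult_minus_right)
    \<comment> \<open>The first part is divisible by \<open>p\<close> because
      \<open>\<sigma>\<close> lifts Frobenius; the second is
      \<open>(d ^ p - d) * \<sigma> r\<close>, divisible by Fermat.\<close>
    also have "of_nat (d ^ p) * \<sigma> r + of_nat d * (- (r ^ p))
        = of_nat d * (\<sigma> r - r ^ p) + of_nat p * (- (e * \<sigma> r))"
      unfolding e by (simp add: algebra_simps)
    also have "\<dots> = of_nat p * (of_nat d * z - e * \<sigma> r)"
      unfolding z by (simp add: algebra_simps)
    also have "tfrac \<dots> (d * d ^ p) = of_nat p * tfrac (of_nat d * z - e * \<sigma> r) (d * d ^ p)"
      using pos[OF dp'] by (simp only: of_nat_times_tfrac)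
    finally show ?thesis unfolding A using dp' by blast
  qed
qed (rule p endo)+

section \<open>Integrality of the formal group law\<close>

lemma fps_const_sum: "fps_const (sum h X :: 'a::comm_ring_1) = (\<Sum>x\<in>X. fps_const (h x))"
  by (induction X rule: infinite_finite_induct) (simp_all flip: fps_const_add)

lemma in_y_mult: "in_y (f * g :: 'a::comm_ring_1 fps) = in_y f * in_y g"
  by (rule fps_ext) (simp add: in_y_def fps_mult_nth fps_const_sum)

lemma in_y_1: "in_y (1 :: 'a::comm_ring_1 fps) = 1"
  by (rule fps_ext) (simp add: in_y_def fps_one_nth)

lemma in_y_power: "in_y (f ^ n :: 'a::comm_ring_1 fps) = in_y f ^ n"
  by (induction n) (simp_all add: in_y_mult in_y_1)

lemma in_y_nth: "fps_nth (in_y f) n = fps_const (fps_nth f n)"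
  by (simp add: in_y_def)

text \<open>Here \<open>in_y\<close> acts as extension of scalars, viewing a series in
  \<open>t\<close> as one over the series in \<open>x\<close>.\<close>

lemma in_y_compose: "in_y (f oo g :: 'a::comm_ring_1 fps) = in_y f oo in_y g"
  by (rule fps_ext) (simp add: fps_compose_nth in_y_nth fps_const_sum flip: in_y_power)

lemma in_y_X: "in_y (fps_X :: 'a::comm_ring_1 fps) = fps_X"
  by (rule fps_ext) (simp add: in_y_def fps_X_def)

text \<open>
  \<open>H\<close> is the series \<open>G(xt, t)\<close> in \<open>t\<close>: its coefficient at \<open>t\<^sup>n\<close> is the polynomial in \<open>x\<close> obtained
  from the homogeneous component of degree \<open>n\<close> of \<open>G\<close> by setting \<open>y = 1\<close>.
\<close>

definition homogenizes :: "'a::zero fps fps \<Rightarrow> 'a fps fps \<Rightarrow> bool" where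
  "homogenizes H G \<longleftrightarrow> (\<forall>i j. fps_nth (fps_nth G j) i = fps_nth (fps_nth H (i + j)) i)
     \<and> (\<forall>n i. i > n \<longrightarrow> fps_nth (fps_nth H n) i = 0)"

lemma homogenizes_mult:
  fixes G G' H H' :: "'a::comm_ring_1 fps fps"
  assumes "homogenizes H G" "homogenizes H' G'"
  shows "homogenizes (H * H') (G * G')"
  unfolding homogenizes_def
proof (intro conjI allI impI)
  fix n i :: nat assume "i > n"
  have "fps_nth (fps_nth H a) b * fps_nth (fps_nth H' (n - a)) (i - b) = 0" if "a \<le> n" "b \<le> i" for a b
  proof -
    have "b > a \<or> i - b > n - a" using that \<open>i > n\<close> by linarith
    thus ?thesis using assms by (auto simp: homogenizes_def)
  qed
  thus "fps_nth (fps_nth (H * H') n) i = 0"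
    by (simp add: fps_mult_nth fps_sum_nth)
next
  fix i j
  have "fps_nth (fps_nth (H * H') (i + j)) i
      = (\<Sum>b\<le>i. \<Sum>a\<le>i + j. fps_nth (fps_nth H a) b * fps_nth (fps_nth H' (i + j - a)) (i - b))"
    by (simp add: fps_mult_nth fps_sum_nth atLeast0AtMost) (rule sum.swap)
  also have "\<dots> = (\<Sum>b\<le>i. \<Sum>c\<le>j. fps_nth (fps_nth H (b + c)) b * fps_nth (fps_nth H' (i + j - (b + c))) (i - b))"
  proof (rule sum.cong)
    fix b assume b: "b \<in> {..i}"
    let ?t = "\<lambda>a. fps_nth (fps_nth H a) b * fps_nth (fps_nth H' (i + j - a)) (i - b)"
    have "sum ?t {..i + j} = sum ?t ((\<lambda>c. b + c) ` {..j})"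
    proof (rule sum.mono_neutral_right)
      show "(\<lambda>c. b + c) ` {..j} \<subseteq> {..i + j}" using b by auto
      show "\<forall>a\<in>{..i + j} - (\<lambda>c. b + c) ` {..j}. ?t a = 0"
      proof
        fix a assume a: "a \<in> {..i + j} - (\<lambda>c. b + c) ` {..j}"
        \<comment> \<open>Otherwise \<open>a = b + c\<close> with \<open>0 \<le> c \<le> j\<close>.
          In either case listed, the degree in \<open>x\<close> exceeds the degree in
          \<open>t\<close> in one factor, whose coefficient then vanishes.\<close>
        have "a < b \<or> i - b > i + j - a"
        proof (rule ccontr)
          assume "\<not> ?thesis"
          hence "a = b + (a - b)" "a - b \<in> {..j}" using a b by auto
          thus False using a by blast
        qed
        thus "?t a = 0" using assms by (auto simp: homogenizes_def)
      qed
    qed simp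
    also have "\<dots> = (\<Sum>c\<le>j. ?t (b + c))"
      by (subst sum.reindex) auto
    finally show "sum ?t {..i + j} = (\<Sum>c\<le>j. ?t (b + c))" .
  qed simp
  also have "\<dots> = (\<Sum>b\<le>i. \<Sum>c\<le>j. fps_nth (fps_nth G c) b * fps_nth (fps_nth G' (j - c)) (i - b))"
    using assms by (intro sum.cong) (auto simp: homogenizes_def)
  also have "\<dots> = fps_nth (fps_nth (G * G') j) i"
    by (simp add: fps_mult_nth fps_sum_nth atLeast0AtMost) (rule sum.swap)
  finally show "fps_nth (fps_nth (G * G') j) i = fps_nth (fps_nth (H * H') (i + j)) i" ..
qed

lemma homogenizes_power:
  fixes G H :: "'a::comm_ring_1 fps fps"
  assumes "homogenizes H G"
  shows "homogenizes (H ^ k) (G ^ k)"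
proof (induction k)
  case 0
  show ?case by (auto simp: homogenizes_def fps_one_nth)
next
  case (Suc k)
  thus ?case using homogenizes_mult[OF assms Suc] by simp
qed

text \<open>The total degree in \<open>x\<close> and \<open>y\<close> becomes the degree in
  \<open>t\<close>, so \<open>oo\<close> truncates at the same place as
  \<open>compose_xy\<close>.\<close>

lemma compose_xy_homogenizes:
  assumes "homogenizes H G"
  shows "fps_nth (fps_nth (compose_xy h G) j) i = fps_nth (fps_nth (in_y h oo H) (i + j)) i"
  using homogenizes_power[OF assms]
  by (simp add: compose_xy_def fps_compose_nth in_y_nth fps_sum_nth atLeast0AtMost homogenizes_def)

text \<open>The series \<open>f(xt) + f(t)\<close> in \<open>t\<close>.\<close>

definition log_sum :: "'a::comm_ring_1 fps \<Rightarrow> 'a fps fps" where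
  "log_sum f = Abs_fps (\<lambda>n. fps_const (fps_nth f n) * (1 + fps_X ^ n))"

lemma homogenizes_log_sum: "homogenizes (log_sum f) (in_x f + in_y f)"
  by (auto simp: homogenizes_def log_sum_def in_x_def in_y_def fps_one_nth algebra_simps)

section \<open>Integrality of a group law from the functional equation of its logarithm\<close>

context frobenius_subring
begin

lemma funpow_fps_frob_const: "(fps_frob p \<phi> ^^ j) (fps_const a) = fps_const ((\<phi> ^^ j) a)"
  by (rule fps_ext) (use prime_pos in \<open>auto simp: funpow_fps_frob_nth' endo_funpow_simps(1) elim!: dvdE\<close>)

lemma funpow_fps_frob_X_power: "(fps_frob p \<phi> ^^ j) (fps_X ^ n) = fps_X ^ (p ^ j * n)"
  using prime_pos by (intro fps_ext) (auto simp: funpow_fps_frob_nth' endo_funpow_simps(1,2))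

text \<open>The functional equation lemma is applied over \<open>fps_over A\<close>, whose Frobenius
  sends \<open>x\<close> to \<open>x ^ p\<close>. With this Frobenius, \<open>f(t)\<close> and
  \<open>f(xt) + f(t)\<close> satisfy the functional equation with the same constants
  \<open>s j\<close>.\<close>

theorem group_law_of_log_integral:
  assumes f: "hazewinkel s f" "fps_nth f 0 = 0" "fps_nth f 1 = 1"
    and f_den: "\<And>k. k > 0 \<Longrightarrow> of_nat (p ^ multiplicity p k) * fps_nth f k \<in> A"
    and s: "\<And>j. j > 0 \<Longrightarrow> of_nat p * s j \<in> A"
  shows "fps_nth (fps_nth (group_law_of_log f) j) i \<in> A"
proof -
  let ?\<Psi> = "fps_frob p \<phi>"
  interpret X: frobenius_subring p "fps_over A" ?\<Psi>
    by (rule frobenius_subring_fps)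
  define g where "g = comp_inverse f"
  have g: "fps_nth g 0 = 0" "f oo g = fps_X"
    using theI'[OF comp_inverse_exists_unique[OF f(2,3)]] by (auto simp: g_def comp_inverse_def)
  define F where "F = in_y g oo log_sum f"
  have const_mem: "fps_const a \<in> fps_over A" if "a \<in> A" for a
    using that zero_closed by (auto simp: fps_over_def)
  let ?s = "\<lambda>j. fps_const (s j)"
  have twist: "X.hazewinkel ?s (log_sum f)" "X.hazewinkel ?s (in_y f)"
  proof -
    let ?d = "\<lambda>n. fps_nth f n - (\<Sum>j=1..n. s j * fps_nth ((?\<Psi> ^^ j) f) n)"
    have d: "fps_const (?d n) \<in> fps_over A" if "n > 0" for n
      using f(1) that by (intro const_mem) (simp add: hazewinkel_def)
    have y: "fps_nth ((fps_frob p ?\<Psi> ^^ j) (in_y f)) n = fps_const (fps_nth ((?\<Psi> ^^ j) f) n)" for j n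
      by (simp add: X.funpow_fps_frob_nth' funpow_fps_frob_nth' in_y_nth funpow_fps_frob_const)
    \<comment> \<open>The iterated Frobenius turns \<open>x ^ (n div p ^ j)\<close> back into
      \<open>x ^ n\<close>, so \<open>1 + x ^ n\<close> is a common factor of all terms in degree
      \<open>n\<close>.\<close>
    have x: "fps_nth ((fps_frob p ?\<Psi> ^^ j) (log_sum f)) n
        = fps_const (fps_nth ((?\<Psi> ^^ j) f) n) * (1 + fps_X ^ n)" for j n
      by (simp add: X.funpow_fps_frob_nth' funpow_fps_frob_nth' log_sum_def funpow_fps_frob_const
          funpow_fps_frob_X_power X.endo_funpow_simps(2,3,4))
    show "X.hazewinkel ?s (in_y f)"
      unfolding X.hazewinkel_def
    proof (intro allI impI)
      fix n :: nat assume n: "n > 0"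
      have "fps_nth (in_y f) n - (\<Sum>j=1..n. ?s j * fps_nth ((fps_frob p ?\<Psi> ^^ j) (in_y f)) n)
          = fps_const (?d n)"
        by (simp add: y in_y_nth fps_const_sum flip: fps_const_sub fps_const_mult)
      thus "fps_nth (in_y f) n - (\<Sum>j=1..n. ?s j * fps_nth ((fps_frob p ?\<Psi> ^^ j) (in_y f)) n)
          \<in> fps_over A" using d[OF n] by simp
    qed
    show "X.hazewinkel ?s (log_sum f)"
      unfolding X.hazewinkel_def
    proof (intro allI impI)
      fix n :: nat assume n: "n > 0"
      have "fps_nth (log_sum f) n - (\<Sum>j=1..n. ?s j * fps_nth ((fps_frob p ?\<Psi> ^^ j) (log_sum f)) n)
          = fps_const (?d n) * (1 + fps_X ^ n)"
        unfolding x
        by (simp add: log_sum_def fps_const_sum left_diff_distrib sum_distrib_right mult.assoc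
            flip: fps_const_sub fps_const_mult)
      moreover have "1 + fps_X ^ n \<in> fps_over A"
        using X.add_closed[OF fps_over_one] fps_over_monomial[OF one_closed, of n] by simp
      ultimately show "fps_nth (log_sum f) n
          - (\<Sum>j=1..n. ?s j * fps_nth ((fps_frob p ?\<Psi> ^^ j) (log_sum f)) n) \<in> fps_over A"
        using d[OF n] by (simp add: fps_over_mult)
    qed
  qed
  have F0: "fps_nth F 0 = 0" by (simp add: F_def in_y_nth g(1))
  have L0: "fps_nth (log_sum f) 0 = 0" by (simp add: log_sum_def f(2))
  have "in_y f oo F = (in_y f oo in_y g) oo log_sum f"
    unfolding F_def by (rule fps_compose_assoc_comm_ring) (simp_all add: in_y_nth g(1) L0)
  also have "\<dots> = log_sum f"
    by (simp add: g(2) in_y_X L0 flip: in_y_compose)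
  finally have comp: "in_y f oo F = log_sum f" .
  have "F \<in> fps_over (fps_over A)"
  proof (rule X.functional_equation_lemma[OF twist(2) _ _ _ _ twist(1) F0])
    show "in_y f oo F = log_sum f" by (rule comp)
    show "of_nat (p ^ multiplicity p k) * fps_nth (in_y f) k \<in> fps_over A" if "k > 0" for k
      using const_mem[OF f_den[OF that]]
      by (simp add: in_y_nth fps_of_nat flip: fps_const_mult del: of_nat_power)
    show "of_nat p * ?s j \<in> fps_over A" if "j > 0" for j
      using const_mem[OF s[OF that]] by (simp add: fps_of_nat flip: fps_const_mult)
  qed (simp_all add: in_y_nth f(2,3)[simplified])
  moreover have "fps_nth (fps_nth (group_law_of_log f) j) i = fps_nth (fps_nth F (i + j)) i"
    unfolding group_law_of_log_def F_def g_def
    by (rule compose_xy_homogenizes[OF homogenizes_log_sum])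
  ultimately show ?thesis by (simp add: fps_over_def)
qed

end

theorem mainTheorem4:
  fixes V :: "('r::{comm_ring_1, ring_char_0}, 'm::finite) laurent_poly"
    and w :: "int ^ 'm"
    and p :: nat
  assumes "inj (of_base :: 'r \<Rightarrow> 'r tensor_rat)"
    and "{real_vec w} = rel_interior (newton_polytope V) \<inter> range real_vec"
    and "prime p"
    and "\<exists>\<sigma> :: 'r \<Rightarrow> 'r. frobenius_lift p \<sigma>"
  shows "\<forall>i j. fps_nth (fps_nth (F_law V w) j) i \<in> tensor_Z_loc p"
proof -
  note p = \<open>prime p\<close>
  have p0: "p > 0" using p by (rule prime_gt_0_nat)
  obtain \<sigma> :: "'r \<Rightarrow> 'r" where \<sigma>: "frobenius_lift p \<sigma>" using assms(4) by blast
  hence endo: "ring_endomorphism \<sigma>" by (simp add: frobenius_lift_def)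
  obtain \<sigma>' where \<sigma>': "ring_endomorphism \<sigma>'" "\<And>r n. n > 0 \<Longrightarrow> \<sigma>' (tfrac r n) = tfrac (\<sigma> r) n"
    using tensor_rat_endomorphism[OF endo] by blast
  interpret frobenius_subring p "tensor_Z_loc p" \<sigma>'
    by (rule frobenius_subring_tensor_Z_loc[OF p \<sigma> \<sigma>'])
  have funpow: "(\<sigma>' ^^ j) (tfrac r n) = tfrac ((\<sigma> ^^ j) r) n" if "n > 0" for j r n
    using that by (induction j) (simp_all add: \<sigma>'(2))
  have mem: "tfrac r d \<in> tensor_Z_loc p" if "\<not> p dvd d" for r :: 'r and d
    unfolding tensor_Z_loc_tfrac[OF p] using that by blast
  let ?b = "central_coeff V w"
  let ?f = "log_series V w"
  have f: "fps_nth ?f n = tfrac (?b (n - 1)) n" if "n > 0" for n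
    using that by (simp add: log_series_def tfrac_conv_tensor)
  obtain c where c: "\<And>m s. m \<ge> 1 \<Longrightarrow> \<exists>d. ?b (m * p ^ s - 1)
      - (\<Sum>j=1..s. of_nat (p ^ (j - 1)) * c j * (\<sigma> ^^ j) (?b (m * p ^ (s - j) - 1))) = of_nat (p ^ s) * d"
    using central_coeff_congruence[OF assms(2) p \<sigma>] by blast
  define s where "s j = tfrac (c j) p" for j
  have decomp: "\<exists>m e. n = m * p ^ e \<and> \<not> p dvd m \<and> multiplicity p n = e" if "n > 0" for n
  proof -
    have "n = p ^ multiplicity p n * (n div p ^ multiplicity p n)"
      by (simp add: multiplicity_dvd)
    moreover have "\<not> p dvd n div p ^ multiplicity p n"
      using that p by (intro multiplicity_decompose) (auto dest: prime_gt_1_nat)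
    ultimately show ?thesis by (metis mult.commute)
  qed
  have "hazewinkel s ?f"
    unfolding hazewinkel_def
  proof (intro allI impI)
    fix n :: nat assume "n > 0"
    then obtain m e where n: "n = m * p ^ e" and m: "\<not> p dvd m" using decomp by blast
    have m0: "m > 0" using m by (metis dvd_0_right neq0_conv)
    obtain d where d: "?b (m * p ^ e - 1)
      - (\<Sum>j=1..e. of_nat (p ^ (j - 1)) * c j * (\<sigma> ^^ j) (?b (m * p ^ (e - j) - 1))) = of_nat (p ^ e) * d"
      using c[of m e] m0 by auto
    have dvd: "p ^ j dvd n \<longleftrightarrow> j \<le> e" for j
    proof
      assume "p ^ j dvd n"
      show "j \<le> e"
      proof (rule ccontr)
        assume "\<not> j \<le> e"
        hence "p ^ Suc e dvd m * p ^ e" using \<open>p ^ j dvd n\<close> n by (metis not_less_eq_eq power_le_dvd)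
        thus False using m p0 by simp
      qed
    qed (auto simp: n le_imp_power_dvd)
    have e: "e \<le> n"
    proof -
      have "e \<le> p ^ e" using less_prime_power[of e] by simp
      also have "\<dots> \<le> n" using m0 by (simp add: n)
      finally show ?thesis .
    qed
    have "(\<Sum>j=1..n. s j * fps_nth ((fps_frob p \<sigma>' ^^ j) ?f) n)
        = (\<Sum>j=1..e. s j * fps_nth ((fps_frob p \<sigma>' ^^ j) ?f) n)"
      using e by (intro sum.mono_neutral_right) (auto simp: funpow_fps_frob_nth' dvd)
    also have "\<dots> = (\<Sum>j=1..e. tfrac (of_nat (p ^ (j - 1)) * c j * (\<sigma> ^^ j) (?b (m * p ^ (e - j) - 1))) n)"
    proof (rule sum.cong)
      fix j assume j: "j \<in> {1..e}"
      let ?n = "m * p ^ (e - j)"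
      have nj: "n = ?n * p ^ j" using j by (simp add: n flip: power_add)
      have n0: "?n > 0" using m0 p0 by simp
      have "s j * fps_nth ((fps_frob p \<sigma>' ^^ j) ?f) n = tfrac (c j) p * (\<sigma>' ^^ j) (fps_nth ?f ?n)"
        using j p0 by (simp add: funpow_fps_frob_nth' dvd s_def nj)
      also have "\<dots> = tfrac (c j * (\<sigma> ^^ j) (?b (?n - 1))) (p * ?n)"
        using n0 p0 by (simp add: f funpow mult_tfrac)
      \<comment> \<open>As \<open>n = ?n * p ^ j\<close>, expanding by \<open>p ^ (j - 1)\<close>
        gives all terms the denominator \<open>n\<close>.\<close>
      also have "\<dots> = tfrac (of_nat (p ^ (j - 1)) * (c j * (\<sigma> ^^ j) (?b (?n - 1)))) (p ^ (j - 1) * (p * ?n))"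
        using n0 p0 by (intro tfrac_cancel[symmetric]) auto
      also have "p ^ (j - 1) * (p * ?n) = n"
        using j unfolding nj by (cases j) (simp_all add: mult_ac)
      finally show "s j * fps_nth ((fps_frob p \<sigma>' ^^ j) ?f) n
          = tfrac (of_nat (p ^ (j - 1)) * c j * (\<sigma> ^^ j) (?b (?n - 1))) n"
        by (simp only: mult.assoc)
    qed simp
    also have "\<dots> = tfrac (\<Sum>j=1..e. of_nat (p ^ (j - 1)) * c j * (\<sigma> ^^ j) (?b (m * p ^ (e - j) - 1))) n"
      using \<open>n > 0\<close> by (rule tfrac_sum_same)
    \<comment> \<open>The congruence makes the numerator a multiple of \<open>p ^ e\<close>, which
      cancels the \<open>p\<close>-part of \<open>n\<close> and leaves the denominator
      \<open>m\<close> prime to \<open>p\<close>.\<close>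
    finally have "fps_nth ?f n - (\<Sum>j=1..n. s j * fps_nth ((fps_frob p \<sigma>' ^^ j) ?f) n)
        = tfrac (of_nat (p ^ e) * d) (p ^ e * m)"
      using \<open>n > 0\<close> d by (simp add: f tfrac_diff_same n mult.commute)
    also have "\<dots> = tfrac d m" using m0 p0 by (intro tfrac_cancel) auto
    finally show "fps_nth ?f n - (\<Sum>j=1..n. s j * fps_nth ((fps_frob p \<sigma>' ^^ j) ?f) n) \<in> tensor_Z_loc p"
      using mem[OF m] by simp
  qed
  moreover have "of_nat (p ^ multiplicity p k) * fps_nth ?f k \<in> tensor_Z_loc p" if k: "k > 0" for k
  proof -
    obtain m where m: "k = p ^ multiplicity p k * m" "\<not> p dvd m"
      using decomp[OF k] by (metis mult.commute)
    have m0: "m > 0" using m by (metis dvd_0_right neq0_conv)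
    let ?q = "p ^ multiplicity p k"
    have "of_nat ?q * fps_nth ?f k = tfrac (of_nat ?q * ?b (k - 1)) k"
      using k by (simp add: f of_nat_times_tfrac del: of_nat_power)
    also have "\<dots> = tfrac (of_nat ?q * ?b (k - 1)) (?q * m)"
      using m(1) by simp
    also have "\<dots> = tfrac (?b (k - 1)) m"
      using m0 p0 by (intro tfrac_cancel) auto
    finally show ?thesis using mem[OF m(2)] by simp
  qed
  moreover have "of_nat p * s j \<in> tensor_Z_loc p" for j
  proof -
    have "of_nat p * s j = tfrac (of_nat p * c j) (p * 1)"
      using p0 by (simp add: s_def of_nat_times_tfrac)
    also have "\<dots> = tfrac (c j) 1" using p0 by (intro tfrac_cancel) auto
    finally show ?thesis using mem[of 1 "c j"] p by (auto dest: prime_gt_1_nat)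
  qed
  ultimately show ?thesis
    unfolding F_law_def by (auto intro!: group_law_of_log_integral log_series_normalized)
qed

end
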